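(* For all $g\ge0$, $n\ge1$ and $(\mu_1,\dots,\mu_n)$ with $\mu_1\ge 2$... more precisely for every $(g,n)$ and every $\mu_1,\dots,\mu_n$ for which the left side is defined, the generalized Catalan numbers satisfy $$C_{g,n}(\mu_1,\dots,\mu_n)=\sum_{j=2}^n\mu_j\,C_{g,n-1}(\mu_1+\mu_j-2,\mu_2,\dots,\widehat{\mu_j},\dots,\mu_n)$$ $$+\sum_{\alpha+\beta=\mu_1-2}\Big[C_{g-1,n+1}(\alpha,\beta,\mu_2,\dots,\mu_n)+\sum_{\substack{g_1+g_2=g\\ I\sqcup J=\{2,\dots,n\}}}C_{g_1,|I|+1}(\alpha,\mu_I)\,C_{g_2,|J|+1}(\beta,\mu_J)\Big],$$ where $\alpha,\beta$ range over nonnegative integers, $\mu_I=(\mu_i)_{i\in I}$, and the last sum is over all $g_1,g_2\ge 0$ with $g_1+g_2=g$ and all ordered set partitions $(I,J)$ of $\{2,\dots,n\}$.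
   Context: A cellular graph of type $(g,n)$ is the 1-skeleton of a cell decomposition of a connected closed oriented surface of genus $g$ with $n$ vertices labeled by $\{1,\dots,n\}$, identified up to orientation-preserving homeomorphism respecting labels. $D_{g,n}(\mu_1,\dots,\mu_n)$ is the number of such graphs with vertex $i$ of degree $\mu_i$, each weighted by $1/|\mathrm{Aut}(\Gamma)|$. The generalized Catalan number is $C_{g,n}(\mu_1,\dots,\mu_n)=\mu_1\cdots\mu_n D_{g,n}(\mu_1,\dots,\mu_n)$ (a nonnegative integer, counting such graphs with an arrow placed on one incident half-edge at each vertex). Conventions: $C_{0,1}(0)=1$; $C_{g,n}(\mu)=0$ whenever some $\mu_i=0$ in all other cases; and $C_{g,n}=0$ if $g<0$.
   Formalization: All μ_i are assumed positive: with the stated conventions the identity fails for μ_1=0 (for g=0, μ=(0,2) it would read 0=2); if μ_1≥1 and another μ_j=0, both sides vanish by convention. C_{g,n} is counted as arrowed cellular graphs, encoded by half-edge pairings. *)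

theory Defs
  imports Main
begin

text \<open>Combinatorial model of arrowed cellular graphs.  Vertex i (0-based, i < length mu)
  has half-edges (i,0),...,(i, mu!i - 1) listed in the cyclic (counterclockwise) order
  of the oriented surface, starting at the half-edge carrying the arrow.
  A cellular graph with arrows is then exactly a fixed-point-free involution
  (the edge pairing) on the half-edges; vertex labels and arrows kill all automorphisms.\<close>

definition half_edges :: "nat list \<Rightarrow> (nat \<times> nat) set" where
  "half_edges mu = {(i, k). i < length mu \<and> k < mu ! i}"

definition vrot :: "nat list \<Rightarrow> nat \<times> nat \<Rightarrow> nat \<times> nat" where
  "vrot mu h = (fst h, (snd h + 1) mod (mu ! fst h))"

definition is_pairing :: "nat list \<Rightarrow> (nat \<times> nat \<Rightarrow> nat \<times> nat) \<Rightarrow> bool" where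
  "is_pairing mu \<iota> \<longleftrightarrow>
     (\<forall>h \<in> half_edges mu. \<iota> h \<in> half_edges mu \<and> \<iota> (\<iota> h) = h \<and> \<iota> h \<noteq> h) \<and>
     (\<forall>h. h \<notin> half_edges mu \<longrightarrow> \<iota> h = h)"

text \<open>The surface is connected iff the half-edges form one orbit under vertex rotation and pairing.\<close>
definition connected_map :: "nat list \<Rightarrow> (nat \<times> nat \<Rightarrow> nat \<times> nat) \<Rightarrow> bool" where
  "connected_map mu \<iota> \<longleftrightarrow>
     (\<forall>h \<in> half_edges mu. \<forall>h' \<in> half_edges mu.
        (h, h') \<in> ({(x, vrot mu x) | x. x \<in> half_edges mu} \<union> {(x, \<iota> x) | x. x \<in> half_edges mu})\<^sup>*)"

text \<open>Faces are the orbits of the face permutation vrot o pairing.\<close>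
definition num_faces :: "nat list \<Rightarrow> (nat \<times> nat \<Rightarrow> nat \<times> nat) \<Rightarrow> nat" where
  "num_faces mu \<iota> = card {{((vrot mu \<circ> \<iota>) ^^ k) h | k. True} | h. h \<in> half_edges mu}"

text \<open>Euler characteristic: V - E + F = 2 - 2g with V = n, E = (sum mu)/2.\<close>
definition arrowed_graphs :: "int \<Rightarrow> nat list \<Rightarrow> (nat \<times> nat \<Rightarrow> nat \<times> nat) set" where
  "arrowed_graphs g mu = {\<iota>. is_pairing mu \<iota> \<and> connected_map mu \<iota> \<and>
       2 * int (length mu) - int (sum_list mu) + 2 * int (num_faces mu \<iota>) = 4 - 4 * g}"

text \<open>Generalized Catalan number C_{g,n}(mu_1,...,mu_n), n = length mu, with the conventions
  C_{0,1}(0) = 1, C = 0 if some mu_i = 0 otherwise, C = 0 for g < 0.\<close>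
definition Cat :: "int \<Rightarrow> nat list \<Rightarrow> nat" where
  "Cat g mu = (if g < 0 then 0
     else if mu = [0] then (if g = 0 then 1 else 0)
     else if mu = [] \<or> 0 \<in> set mu then 0
     else card (arrowed_graphs g mu))"

text \<open>mu_I for I a set of (0-based) indices, in increasing order.\<close>
definition sublist_idx :: "nat list \<Rightarrow> nat set \<Rightarrow> nat list" where
  "sublist_idx mu I = map (\<lambda>i. mu ! i) (sorted_list_of_set I)"

end

theory Submission
  imports Defs "HOL-Combinatorics.Permutations"
begin

text \<open>
  Remove the edge carrying the arrow of the first vertex. If its other end lies on vertex \<open>j\<close>, the
  edge is contracted and the two vertices merge; each of the \<open>\<mu>\<^sub>j\<close> possible other ends gives every
  smaller graph once. If the edge is a loop, the vertex splits into two vertices of degrees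
  \<open>\<alpha>\<close> and \<open>\<beta>\<close>, and the result is either connected, of genus \<open>g - 1\<close>, or has exactly two
  components, which separate the two new vertices and whose genera add up to \<open>g\<close>.

  On the level of permutations, deleting the edge deletes two points from the cycles of the face
  permutation. A cycle is lost exactly when a vertex of degree 0 appears, so the number of faces is
  preserved if every vertex of degree 0 is counted as one additional face. With this convention
  \<open>C\<^bsub>0,1\<^esub>(0) = 1\<close> is no longer an exception. The recursion for maps with a given number of faces
  also shows, by induction on the number of half-edges, that the Euler characteristic of a connected
  map is even and at most 2; hence both components of a split map have a genus in the range of the sum.
\<close>

subsection \<open>Orbits\<close>

text \<open>List positions would shift whenever vertices merge, split or separate, so the counting
  is done for a set of vertices \<open>V\<close> with a degree function \<open>d\<close>: a deletion
  then changes \<open>d\<close> at one or two vertices and \<open>V\<close> by one element. Since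
  the indices at a vertex begin at its arrow, a deletion must also place new arrows. The dart that
  follows a deleted one opens the new numbering, which makes every deletion a bijection with no
  automorphisms to divide out. Connectedness takes the map \<open>p\<close> from darts to vertices
  as a parameter, so that identifying two vertices is a change of \<open>p\<close> with the darts
  kept. Faces are counted before genera because the effect of cutting a loop on the genus depends on
  whether it separates the surface, a global question, whereas the face permutation changes only
  near the two deleted darts, and in the same way in either case. Separation is then a matter of
  connectedness alone, and Euler's relation turns the sum over pairs of components into the sum over
  \<open>g1\<close>.\<close>

definition orb :: "('a \<Rightarrow> 'a) \<Rightarrow> 'a \<Rightarrow> 'a set" where
  "orb f x = {(f ^^ k) x | k. True}"

lemma orb_refl: "x \<in> orb f x"
  unfolding orb_def by (auto intro: exI[of _ 0])

lemma orb_step: "y \<in> orb f x \<Longrightarrow> f y \<in> orb f x"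
  unfolding orb_def by clarsimp (metis comp_apply funpow.simps(2))

lemma orb_induct [consumes 1, case_names refl step]:
  assumes "y \<in> orb f x" "P x" "\<And>z. z \<in> orb f x \<Longrightarrow> P z \<Longrightarrow> P (f z)"
  shows "P y"
proof -
  have "P ((f ^^ k) x)" for k
  proof (induction k)
    case (Suc k)
    then show ?case using assms(3)[of "(f ^^ k) x"] by (auto simp: orb_def)
  qed (simp add: assms)
  then show ?thesis using assms(1) by (auto simp: orb_def)
qed

lemma orb_subset: "y \<in> orb f x \<Longrightarrow> orb f y \<subseteq> orb f x"
proof
  fix z assume "z \<in> orb f y" "y \<in> orb f x"
  then show "z \<in> orb f x" by (induction rule: orb_induct) (auto intro: orb_step)
qed

lemma orb_closed:
  assumes "y \<in> orb f x" "x \<in> H" "\<And>z. z \<in> H \<Longrightarrow> f z \<in> H"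
  shows "y \<in> H"
  using assms by (induction rule: orb_induct) auto

text \<open>An injective self-map of a finite set permutes each forward orbit, so iterating forwards
  eventually leads back. This is what makes forward orbits the cycles of a permutation.\<close>

lemma orb_sym:
  assumes "finite H" "inj_on f H" "f ` H \<subseteq> H" "x \<in> H" "y \<in> orb f x"
  shows "x \<in> orb f y"
  using assms(5)
proof (induction rule: orb_induct)
  case refl
  show ?case by (rule orb_refl)
next
  case (step z)
  have z: "z \<in> H" using orb_closed[OF step(1), of H] assms by auto
  have sub: "orb f z \<subseteq> H" using orb_closed[OF _ z] assms(3) by blast
  have im: "f ` orb f z = orb f z"
    using sub assms(1,2) 
    by (intro endo_inj_surj) (auto intro: orb_step finite_subset inj_on_subset)
  have "orb f z = insert z (orb f (f z))"
  proof
    show "orb f z \<subseteq> insert z (orb f (f z))"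
    proof
      fix w assume "w \<in> orb f z"
      then show "w \<in> insert z (orb f (f z))"
        by (induction rule: orb_induct) (auto intro: orb_step orb_refl)
    qed
    show "insert z (orb f (f z)) \<subseteq> orb f z"
      using orb_subset[OF orb_step[OF orb_refl[of z f]]] orb_refl[of z f] by simp
  qed
  \<comment> \<open>\<open>z\<close> has a predecessor \<open>w\<close> in its own orbit. Either
    \<open>w = z\<close>, a fixed point, or \<open>w\<close> lies in the orbit of
    \<open>f z\<close>; in both cases \<open>z\<close> is reached from \<open>f z\<close>.\<close>
  obtain w where w: "w \<in> orb f z" "f w = z" using im orb_refl[of z f] by (metis imageE)
  have "z \<in> orb f (f z)"
    using \<open>orb f z = insert z (orb f (f z))\<close> w orb_step orb_refl by (metis insertE)
  then show ?case using step(2) orb_subset[of z f "f z"] by auto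
qed

lemma orb_eq:
  assumes "finite H" "inj_on f H" "f ` H \<subseteq> H" "x \<in> H" "y \<in> orb f x"
  shows "orb f y = orb f x"
  using orb_subset[OF assms(5)] orb_subset[OF orb_sym[OF assms]] by blast

lemma orb_cong:
  assumes "x \<in> H" "\<And>z. z \<in> H \<Longrightarrow> f z \<in> H" "\<And>z. z \<in> H \<Longrightarrow> f z = g z"
  shows "orb f x = orb g x"
proof -
  have eq: "(f ^^ k) x = (g ^^ k) x \<and> (f ^^ k) x \<in> H" for k
    by (induction k) (use assms in auto)
  then show ?thesis unfolding orb_def by auto
qed

lemma orb_conj:
  assumes "x \<in> A" "\<And>z. z \<in> A \<Longrightarrow> s z \<in> A" "\<And>z. z \<in> A \<Longrightarrow> f (s z) = s' (f z)"
  shows "orb s' (f x) = f ` orb s x"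
proof -
  have eq: "(s' ^^ k) (f x) = f ((s ^^ k) x) \<and> (s ^^ k) x \<in> A" for k
    by (induction k) (use assms in auto)
  then show ?thesis unfolding orb_def by auto
qed

lemma card_orbs_conj:
  assumes f: "bij_betw f A B" and s: "\<And>z. z \<in> A \<Longrightarrow> s z \<in> A"
    and c: "\<And>z. z \<in> A \<Longrightarrow> f (s z) = s' (f z)"
  shows "card (orb s' ` B) = card (orb s ` A)"
proof -
  have B: "B = f ` A" using f by (simp add: bij_betw_def)
  have "orb s' ` B = (`) f ` (orb s ` A)"
    unfolding B image_image using orb_conj[of _ A s f s'] s c by (auto intro!: image_cong)
  moreover have "orb s x \<subseteq> A" if "x \<in> A" for x
    using orb_closed[of _ s x A] that s by blast
  then have "orb s ` A \<subseteq> Pow A" by blast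
  then have "inj_on ((`) f) (orb s ` A)"
    using f by (meson bij_betw_def inj_on_image_Pow inj_on_subset)
  ultimately show ?thesis by (simp add: card_image)
qed

text \<open>\<open>f'\<close> bypasses \<open>h\<close>, so each cycle through another point
  survives with \<open>h\<close> erased. A cycle disappears only if it consisted of \<open>h\<close>
  alone.\<close>

lemma card_orbs_remove:
  assumes fin: "finite H" and inj: "inj_on f H" and into: "f ` H \<subseteq> H" and h: "h \<in> H"
  defines "f' \<equiv> \<lambda>x. if f x = h then f h else f x"
  shows "card (orb f ` H) = card (orb f' ` (H - {h})) + (if f h = h then 1 else 0)"
    and "f' ` (H - {h}) \<subseteq> H - {h}" and "inj_on f' (H - {h})"
proof -
  show into': "f' ` (H - {h}) \<subseteq> H - {h}"
    using into inj h by (auto simp: f'_def inj_on_def)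
  show "inj_on f' (H - {h})"
    using inj h unfolding f'_def inj_on_def by (auto split: if_splits)
  have orb': "orb f' x = orb f x - {h}" if x: "x \<in> H - {h}" for x
  proof
    show "orb f' x \<subseteq> orb f x - {h}"
    proof
      fix y assume y: "y \<in> orb f' x"
      then have "y \<in> H - {h}" using orb_closed[OF y x] into' by blast
      moreover have "y \<in> orb f x"
        using y by (induction rule: orb_induct) (auto simp: f'_def orb_refl intro: orb_step dest: orb_step)
      ultimately show "y \<in> orb f x - {h}" by blast
    qed
    have sub: "orb f' x \<subseteq> H - {h}" using orb_closed[OF _ x] into' by blast
    \<comment> \<open>Follow the \<open>f\<close>-orbit of \<open>x\<close>. While it sits at
      \<open>h\<close>, the bypassing map has already moved on to \<open>f h\<close>; otherwise both
      are at the same point.\<close>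
    have inv: "(y \<noteq> h \<and> y \<in> orb f' x) \<or> (y = h \<and> f h \<in> orb f' x)" if "y \<in> orb f x" for y
      using that
    proof (induction rule: orb_induct)
      case refl
      then show ?case using x by (simp add: orb_refl)
    next
      case (step z)
      show ?case
      proof (cases "z = h")
        case True
        then show ?thesis using step sub by auto
      next
        case False
        then have "f' z \<in> orb f' x" using step by (auto intro: orb_step)
        then show ?thesis by (auto simp: f'_def split: if_splits)
      qed
    qed
    then show "orb f x - {h} \<subseteq> orb f' x" by auto
  qed
  have im: "orb f' ` (H - {h}) = (\<lambda>S. S - {h}) ` (orb f ` (H - {h}))"
    by (auto simp: image_image orb' intro!: image_cong)
  have "inj_on (\<lambda>S. S - {h}) (orb f ` (H - {h}))"
  proof (rule inj_onI)
    fix S T assume S: "S \<in> orb f ` (H - {h})" and T: "T \<in> orb f ` (H - {h})" and eq: "S - {h} = T - {h}"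
    obtain x y where x: "S = orb f x" "x \<in> H" "x \<noteq> h" and y: "T = orb f y" "y \<in> H"
      using S T by auto
    have "x \<in> orb f y" using eq x y orb_refl[of x f] by blast
    then show "S = T" using orb_eq[OF fin inj into y(2)] x y by simp
  qed
  then have c: "card (orb f' ` (H - {h})) = card (orb f ` (H - {h}))"
    by (simp add: im card_image)
  have H: "orb f ` H = insert (orb f h) (orb f ` (H - {h}))" using h by blast
  have "orb f h \<in> orb f ` (H - {h}) \<longleftrightarrow> f h \<noteq> h"
  proof
    assume "f h \<noteq> h"
    then have "f h \<in> H - {h}" "orb f (f h) = orb f h"
      using into h orb_eq[OF fin inj into h orb_step[OF orb_refl]] by auto
    then show "orb f h \<in> orb f ` (H - {h})" by (metis imageI)
  next
    assume "orb f h \<in> orb f ` (H - {h})"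
    then obtain x where x: "x \<in> H" "x \<noteq> h" "x \<in> orb f h" using orb_refl by fastforce
    show "f h \<noteq> h"
    proof
      assume "f h = h"
      with x(3) have "x = h" by (induction rule: orb_induct) auto
      with x show False by simp
    qed
  qed
  then show "card (orb f ` H) = card (orb f' ` (H - {h})) + (if f h = h then 1 else 0)"
    using fin by (auto simp: c H card_insert_if insert_absorb)
qed

lemma card_orbs_Un:
  assumes "finite A" "finite B" "A \<inter> B = {}" "f ` A \<subseteq> A" "f ` B \<subseteq> B"
  shows "card (orb f ` (A \<union> B)) = card (orb f ` A) + card (orb f ` B)"
proof -
  have "orb f ` A \<inter> orb f ` B = {}"
  proof (rule ccontr)
    assume "orb f ` A \<inter> orb f ` B \<noteq> {}"
    then obtain x y where xy: "x \<in> A" "y \<in> B" "orb f x = orb f y" by auto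
    have "x \<in> B" using orb_closed[of x f y B] xy orb_refl[of x f] assms(5) by (simp add: image_subset_iff)
    then show False using xy assms by auto
  qed
  then show ?thesis using assms by (simp add: image_Un card_Un_disjoint)
qed

subsection \<open>Pairings and connectedness\<close>

definition pairing :: "'a set \<Rightarrow> ('a \<Rightarrow> 'a) \<Rightarrow> bool" where
  "pairing H \<iota> \<longleftrightarrow> (\<forall>h\<in>H. \<iota> h \<in> H \<and> \<iota> (\<iota> h) = h \<and> \<iota> h \<noteq> h) \<and> (\<forall>h. h \<notin> H \<longrightarrow> \<iota> h = h)"

lemma pairing_outside: "pairing H \<iota> \<Longrightarrow> h \<notin> H \<Longrightarrow> \<iota> h = h"
  by (simp add: pairing_def)

lemma pairing_permutes: "pairing H \<iota> \<Longrightarrow> \<iota> permutes H"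
  by (rule bij_imp_permutes, rule bij_betw_byWitness[where f' = \<iota>]) (auto simp: pairing_def)

lemma finite_pairings: "finite H \<Longrightarrow> finite {\<iota>. pairing H \<iota>}"
  using finite_permutations[of H] by (rule finite_subset[rotated]) (auto intro: pairing_permutes)

section \<open>Conjugating pairings by a bijection of half-edges\<close>

definition transport :: "'a set \<Rightarrow> 'b set \<Rightarrow> ('a \<Rightarrow> 'b) \<Rightarrow> ('a \<Rightarrow> 'a) \<Rightarrow> 'b \<Rightarrow> 'b" where
  "transport A B f \<iota> = (\<lambda>y. if y \<in> B then f (\<iota> (inv_into A f y)) else y)"

lemma transport_apply: "bij_betw f A B \<Longrightarrow> x \<in> A \<Longrightarrow> transport A B f \<iota> (f x) = f (\<iota> x)"
  by (auto simp: transport_def bij_betw_def)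

lemma pairing_transport:
  assumes f: "bij_betw f A B" and \<iota>: "pairing A \<iota>"
  shows "pairing B (transport A B f \<iota>)"
proof -
  have "transport A B f \<iota> y \<in> B \<and> transport A B f \<iota> (transport A B f \<iota> y) = y \<and> transport A B f \<iota> y \<noteq> y"
    if y: "y \<in> B" for y
  proof -
    obtain x where x: "x \<in> A" "y = f x" using bij_betw_imp_surj_on[OF f] y by auto
    have i: "\<iota> x \<in> A" "\<iota> (\<iota> x) = x" "\<iota> x \<noteq> x" using \<iota> x by (auto simp: pairing_def)
    have "f (\<iota> x) \<in> B" "f (\<iota> x) \<noteq> f x" using f i x by (auto simp: bij_betw_def inj_on_def)
    then show ?thesis by (simp add: x i transport_apply[OF f])
  qed
  moreover have "transport A B f \<iota> y = y" if "y \<notin> B" for y using that by (simp add: transport_def)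
  ultimately show ?thesis unfolding pairing_def by blast
qed

lemma bij_transport:
  assumes f: "bij_betw f A B"
  shows "bij_betw (transport A B f) {\<iota>. pairing A \<iota>} {\<iota>. pairing B \<iota>}"
proof (rule bij_betw_byWitness)
  have g: "bij_betw (inv_into A f) B A" by (rule bij_betw_inv_into[OF f])
  have inv: "inv_into A f (f x) = x" if "x \<in> A" for x using f that by (simp add: bij_betw_def)
  have inv': "inv_into B (inv_into A f) x = f x" if "x \<in> A" for x
    using f that by (simp add: inv_into_inv_into_eq)
  have inv'': "f (inv_into A f y) = y" "inv_into A f y \<in> A" if "y \<in> B" for y
    using f that by (auto simp: bij_betw_def f_inv_into_f inv_into_into)
  show "\<forall>\<iota>\<in>{\<iota>. pairing A \<iota>}. transport B A (inv_into A f) (transport A B f \<iota>) = \<iota>"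
  proof (intro ballI ext, unfold mem_Collect_eq)
    fix \<iota> x assume \<iota>: "pairing A \<iota>"
    show "transport B A (inv_into A f) (transport A B f \<iota>) x = \<iota> x"
    proof (cases "x \<in> A")
      case True
      then have "f x \<in> B" "\<iota> x \<in> A" using f \<iota> by (auto simp: bij_betw_def pairing_def)
      then show ?thesis using True by (simp add: transport_def inv inv')
    next
      case False
      then show ?thesis using \<iota> by (auto simp: transport_def pairing_def)
    qed
  qed
  show "\<forall>\<iota>\<in>{\<iota>. pairing B \<iota>}. transport A B f (transport B A (inv_into A f) \<iota>) = \<iota>"
  proof (intro ballI ext, unfold mem_Collect_eq)
    fix \<iota> y assume \<iota>: "pairing B \<iota>"
    show "transport A B f (transport B A (inv_into A f) \<iota>) y = \<iota> y"
    proof (cases "y \<in> B")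
      case True
      then have "\<iota> y \<in> B" using \<iota> by (auto simp: pairing_def)
      then show ?thesis using True inv'' by (simp add: transport_def inv')
    next
      case False
      then show ?thesis using \<iota> by (auto simp: transport_def pairing_def)
    qed
  qed
  show "transport A B f ` {\<iota>. pairing A \<iota>} \<subseteq> {\<iota>. pairing B \<iota>}"
    using pairing_transport[OF f] by auto
  show "transport B A (inv_into A f) ` {\<iota>. pairing B \<iota>} \<subseteq> {\<iota>. pairing A \<iota>}"
    using pairing_transport[OF g] by auto
qed

text \<open>If \<open>f\<close> intertwines the rotations \<open>s\<close> and \<open>s'\<close>, it
  also intertwines the face permutations, as \<open>transport\<close> is conjugation by
  \<open>f\<close>.\<close>

lemma card_orbs_transport:
  assumes f: "bij_betw f A B" and \<iota>: "pairing A \<iota>"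
    and s: "\<And>x. x \<in> A \<Longrightarrow> s x \<in> A" and c: "\<And>x. x \<in> A \<Longrightarrow> f (s x) = s' (f x)"
  shows "card (orb (s' \<circ> transport A B f \<iota>) ` B) = card (orb (s \<circ> \<iota>) ` A)"
  using \<iota> s c by (intro card_orbs_conj[OF f]) (auto simp: pairing_def transport_apply[OF f])

text \<open>Connectedness is stated without paths: no proper nonempty set of vertices is closed under
  following edges. Isolated vertices are thereby covered as well.\<close>
definition closed_under :: "'a set \<Rightarrow> ('a \<Rightarrow> 'v) \<Rightarrow> ('a \<Rightarrow> 'a) \<Rightarrow> 'v set \<Rightarrow> bool" where
  "closed_under H p \<iota> S \<longleftrightarrow> (\<forall>h\<in>H. p h \<in> S \<longrightarrow> p (\<iota> h) \<in> S)"

definition vconn :: "'v set \<Rightarrow> 'a set \<Rightarrow> ('a \<Rightarrow> 'v) \<Rightarrow> ('a \<Rightarrow> 'a) \<Rightarrow> bool" where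
  "vconn V H p \<iota> \<longleftrightarrow> V \<noteq> {} \<and> (\<forall>S\<subseteq>V. S \<noteq> {} \<longrightarrow> closed_under H p \<iota> S \<longrightarrow> S = V)"

lemma vconnD: "vconn V H p \<iota> \<Longrightarrow> S \<subseteq> V \<Longrightarrow> S \<noteq> {} \<Longrightarrow> closed_under H p \<iota> S \<Longrightarrow> S = V"
  unfolding vconn_def by simp

lemma closed_under_transport:
  assumes f: "bij_betw f A B" and \<iota>: "pairing A \<iota>"
    and q: "\<And>x. x \<in> A \<Longrightarrow> q (f x) = r (p x)"
    and r: "inj_on r V" and p: "\<And>x. x \<in> A \<Longrightarrow> p x \<in> V" and S: "S \<subseteq> V"
  shows "closed_under B q (transport A B f \<iota>) (r ` S) \<longleftrightarrow> closed_under A p \<iota> S"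
proof -
  have B: "B = f ` A" using f by (simp add: bij_betw_def)
  have i: "\<iota> x \<in> A" if "x \<in> A" for x using \<iota> that by (auto simp: pairing_def)
  have rS: "r (p x) \<in> r ` S \<longleftrightarrow> p x \<in> S" if "x \<in> A" for x
    using r p[OF that] S by (auto simp: inj_on_def)
  show ?thesis
    unfolding closed_under_def
    by (subst B) (simp add: transport_apply[OF f] q i rS)
qed

text \<open>The subsets of \<open>W\<close> are the images under \<open>r\<close> of the subsets of
  \<open>V\<close>, and corresponding subsets are closed simultaneously. Since \<open>q\<close> may
  differ from \<open>p\<close> in shape, this also covers relabelled and glued vertices.\<close>

lemma conn_transport:
  assumes f: "bij_betw f A B" and \<iota>: "pairing A \<iota>"
    and q: "\<And>x. x \<in> A \<Longrightarrow> q (f x) = r (p x)"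
    and r: "bij_betw r V W" and p: "\<And>x. x \<in> A \<Longrightarrow> p x \<in> V"
  shows "vconn W B q (transport A B f \<iota>) \<longleftrightarrow> vconn V A p \<iota>"
proof -
  have W: "W = r ` V" and inj: "inj_on r V" using r by (auto simp: bij_betw_def)
  note cl = closed_under_transport[OF f \<iota>, of q r p V, OF q inj p]
  show ?thesis
    unfolding vconn_def W all_subset_image using cl inj
    by (auto simp: inj_on_image_eq_iff)
qed

subsection \<open>Deleting an edge\<close>

definition add_edge :: "'a \<Rightarrow> 'a \<Rightarrow> ('a \<Rightarrow> 'a) \<Rightarrow> 'a \<Rightarrow> 'a" where
  "add_edge x y \<iota> = \<iota>(x := y, y := x)"

text \<open>The vertex rotation that remains when \<open>x\<close> and \<open>y\<close> are skipped in the cycles of the face permutation,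
  for a pairing that joins \<open>x\<close> to \<open>y\<close>; it does not depend on the rest of the pairing.\<close>
definition skip_rot :: "('a \<Rightarrow> 'a) \<Rightarrow> 'a \<Rightarrow> 'a \<Rightarrow> 'a \<Rightarrow> 'a" where
  "skip_rot \<sigma> x y = (\<lambda>z. let s = (if \<sigma> z = x then \<sigma> y else \<sigma> z)
     in if s = y then (if \<sigma> x = x then \<sigma> y else \<sigma> x) else s)"

lemma bij_add_edge:
  assumes "x \<in> H" "y \<in> H" "x \<noteq> y"
  shows "bij_betw (add_edge x y) {\<iota>. pairing (H - {x, y}) \<iota>} {\<iota>. pairing H \<iota> \<and> \<iota> x = y}"
proof (rule bij_betw_byWitness[where f' = "\<lambda>\<iota>. \<iota>(x := x, y := y)"])
  show "\<forall>\<iota>\<in>{\<iota>. pairing (H - {x, y}) \<iota>}. (add_edge x y \<iota>)(x := x, y := y) = \<iota>"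
    using assms by (auto simp: pairing_def add_edge_def fun_eq_iff)
  show "\<forall>\<iota>\<in>{\<iota>. pairing H \<iota> \<and> \<iota> x = y}. add_edge x y (\<iota>(x := x, y := y)) = \<iota>"
    using assms by (auto simp: pairing_def add_edge_def fun_eq_iff)
  show "add_edge x y ` {\<iota>. pairing (H - {x, y}) \<iota>} \<subseteq> {\<iota>. pairing H \<iota> \<and> \<iota> x = y}"
  proof clarify
    fix \<iota> assume \<iota>: "pairing (H - {x, y}) \<iota>"
    have "add_edge x y \<iota> h \<in> H \<and> add_edge x y \<iota> (add_edge x y \<iota> h) = h \<and> add_edge x y \<iota> h \<noteq> h"
      if h: "h \<in> H" for h
    proof (cases "h \<in> {x, y}")
      case True
      then show ?thesis using assms by (auto simp: add_edge_def)
    next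
      case False
      then have "\<iota> h \<in> H - {x, y}" "\<iota> (\<iota> h) = h" "\<iota> h \<noteq> h" using \<iota> h by (simp_all add: pairing_def)
      then show ?thesis using False by (simp add: add_edge_def)
    qed
    moreover have "add_edge x y \<iota> h = h" if "h \<notin> H" for h
      using that assms \<iota> by (auto simp: add_edge_def pairing_def)
    moreover have "add_edge x y \<iota> x = y" using assms by (simp add: add_edge_def)
    ultimately show "pairing H (add_edge x y \<iota>) \<and> add_edge x y \<iota> x = y"
      unfolding pairing_def by blast
  qed
  show "(\<lambda>\<iota>. \<iota>(x := x, y := y)) ` {\<iota>. pairing H \<iota> \<and> \<iota> x = y} \<subseteq> {\<iota>. pairing (H - {x, y}) \<iota>}"
  proof clarify
    fix \<iota> assume \<iota>: "pairing H \<iota>"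
    have xx: "\<iota> (\<iota> x) = x" using \<iota> assms by (simp add: pairing_def)
    have "\<iota> h \<in> H - {x, \<iota> x} \<and> \<iota> (\<iota> h) = h \<and> \<iota> h \<noteq> h" if h: "h \<in> H - {x, \<iota> x}" for h
    proof -
      have hh: "\<iota> h \<in> H" "\<iota> (\<iota> h) = h" "\<iota> h \<noteq> h" using \<iota> h by (simp_all add: pairing_def)
      have "\<iota> h \<noteq> x" "\<iota> h \<noteq> \<iota> x" using hh(2) xx h by auto
      then show ?thesis using hh by simp
    qed
    moreover have "\<iota> h = h" if "h \<notin> H" for h using that \<iota> by (simp add: pairing_def)
    ultimately show "pairing (H - {x, \<iota> x}) (\<iota>(x := x, \<iota> x := \<iota> x))"
      unfolding pairing_def by simp
  qed
qed

text \<open>The points \<open>x\<close> and \<open>y\<close> are erased from the face permutation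
  one after the other. The first correction counts a face consisting of \<open>x\<close> alone, the
  second a face that consists of \<open>y\<close> alone once \<open>x\<close> has been
  skipped.\<close>

lemma card_orbs_add_edge:
  assumes fin: "finite H" and inj: "inj_on \<sigma> H" and into: "\<sigma> ` H \<subseteq> H"
    and xy: "x \<in> H" "y \<in> H" "x \<noteq> y" and \<iota>: "pairing (H - {x, y}) \<iota>"
  shows "card (orb (\<sigma> \<circ> add_edge x y \<iota>) ` H) = card (orb (skip_rot \<sigma> x y \<circ> \<iota>) ` (H - {x, y}))
    + (if \<sigma> y = x then 1 else 0) + (if (if \<sigma> x = x then \<sigma> y else \<sigma> x) = y then 1 else 0)"
proof -
  define \<phi> where "\<phi> = \<sigma> \<circ> add_edge x y \<iota>"
  define \<phi>1 where "\<phi>1 = (\<lambda>z. if \<phi> z = x then \<phi> x else \<phi> z)"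
  define \<phi>2 where "\<phi>2 = (\<lambda>z. if \<phi>1 z = y then \<phi>1 y else \<phi>1 z)"
  have "pairing H (add_edge x y \<iota>)"
    using bij_betwE[OF bij_add_edge[OF xy]] \<iota> by blast
  then have perm: "add_edge x y \<iota> permutes H" by (rule pairing_permutes)
  have im: "add_edge x y \<iota> ` H = H" by (rule permutes_image[OF perm])
  have "inj_on \<phi> H" unfolding \<phi>_def
    using inj im permutes_inj_on[OF perm, of H] by (intro comp_inj_on) auto
  moreover have "\<phi> ` H \<subseteq> H" using into im by (auto simp: \<phi>_def)
  ultimately have r1: "card (orb \<phi> ` H) = card (orb \<phi>1 ` (H - {x})) + (if \<phi> x = x then 1 else 0)"
    "\<phi>1 ` (H - {x}) \<subseteq> H - {x}" "inj_on \<phi>1 (H - {x})"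
    using card_orbs_remove[OF fin, of \<phi> x] xy by (auto simp: \<phi>1_def)
  have D: "H - {x} - {y} = H - {x, y}" by auto
  have "y \<in> H - {x}" using xy by auto
  then have r2: "card (orb \<phi>1 ` (H - {x})) = card (orb \<phi>2 ` (H - {x, y})) + (if \<phi>1 y = y then 1 else 0)"
    and into2: "\<phi>2 ` (H - {x, y}) \<subseteq> H - {x, y}"
    using card_orbs_remove[of "H - {x}" \<phi>1 y] r1(2,3) fin D by (auto simp: \<phi>2_def)
  have [simp]: "\<phi> x = \<sigma> y" "\<phi> y = \<sigma> x" using xy by (auto simp: \<phi>_def add_edge_def)
  have y1: "\<phi>1 y = (if \<sigma> x = x then \<sigma> y else \<sigma> x)" by (simp add: \<phi>1_def)
  \<comment> \<open>Away from \<open>x\<close> and \<open>y\<close> the pairing is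
    \<open>\<iota>\<close>, and the detours \<open>\<phi> x = \<sigma> y\<close> and
    \<open>\<phi>1 y\<close> involve the rotation alone. Hence the doubly reduced map factors as a
    new rotation after \<open>\<iota>\<close>.\<close>
  have "\<phi>2 z = (skip_rot \<sigma> x y \<circ> \<iota>) z" if "z \<in> H - {x, y}" for z
    using that by (simp add: \<phi>2_def y1 skip_rot_def Let_def \<phi>1_def) (simp add: \<phi>_def add_edge_def)
  then have "orb \<phi>2 z = orb (skip_rot \<sigma> x y \<circ> \<iota>) z" if "z \<in> H - {x, y}" for z
    using orb_cong[OF that, of \<phi>2] into2 by blast
  then have "orb \<phi>2 ` (H - {x, y}) = orb (skip_rot \<sigma> x y \<circ> \<iota>) ` (H - {x, y})"
    by (rule image_cong[OF refl])
  then show ?thesis using r1(1) r2 y1 by (simp flip: \<phi>_def)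
qed

subsection \<open>Maps with ordered half-edges\<close>

definition darts :: "'v set \<Rightarrow> ('v \<Rightarrow> nat) \<Rightarrow> ('v \<times> nat) set" where
  "darts V d = (SIGMA v:V. {..<d v})"

definition rot :: "('v \<Rightarrow> nat) \<Rightarrow> 'v \<times> nat \<Rightarrow> 'v \<times> nat" where
  "rot d h = (fst h, if Suc (snd h) = d (fst h) then 0 else Suc (snd h))"

text \<open>An isolated vertex lies in one face, which no half-edge sees.\<close>
definition nfaces :: "'v set \<Rightarrow> ('v \<Rightarrow> nat) \<Rightarrow> ('v \<times> nat \<Rightarrow> 'v \<times> nat) \<Rightarrow> nat" where
  "nfaces V d \<iota> = card (orb (rot d \<circ> \<iota>) ` darts V d) + card {v \<in> V. d v = 0}"

definition cmaps :: "'v set \<Rightarrow> ('v \<Rightarrow> nat) \<Rightarrow> ('v \<times> nat \<Rightarrow> 'v \<times> nat) set" where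
  "cmaps V d = {\<iota>. pairing (darts V d) \<iota> \<and> vconn V (darts V d) fst \<iota>}"

lemma mem_darts: "(v, k) \<in> darts V d \<longleftrightarrow> v \<in> V \<and> k < d v"
  by (auto simp: darts_def)

lemma finite_darts: "finite V \<Longrightarrow> finite (darts V d)"
  by (auto simp: darts_def)

lemma rot_into: "rot d ` darts V d \<subseteq> darts V d"
  by (auto simp: rot_def darts_def)

lemma rot_inj: "inj_on (rot d) (darts V d)"
  by (auto simp: rot_def darts_def inj_on_def split: if_splits)

lemma finite_cmaps: "finite V \<Longrightarrow> finite (cmaps V d)"
  unfolding cmaps_def by (rule finite_subset[OF _ finite_pairings[OF finite_darts]]) auto

lemma card_restricted_bij:
  assumes "bij_betw f P Q" "\<And>x. x \<in> P \<Longrightarrow> R x \<longleftrightarrow> R' (f x)"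
  shows "card {x \<in> P. R x} = card {y \<in> Q. R' y}"
proof -
  have "bij_betw f {x \<in> P. R x} {y \<in> Q. R' y}"
    using assms unfolding bij_betw_def inj_on_def by auto
  then show ?thesis by (rule bij_betw_same_card)
qed

text \<open>The common scheme of contraction and cutting. \<open>f\<close> identifies the darts
  \<open>A\<close> of the smaller map with the surviving darts, \<open>s\<close> is its rotation,
  and \<open>Q\<close> is what the connectedness of the large map becomes. The constant
  \<open>c\<close> collects the lost faces and the old isolated vertices; in both applications it is
  the number of isolated vertices after the deletion.\<close>

lemma card_delete_edge:
  fixes f :: "'b \<Rightarrow> 'v \<times> nat"
  assumes fin: "finite V" and xy: "x \<in> darts V d" "y \<in> darts V d" "x \<noteq> y"
    and f: "bij_betw f A (darts V d - {x, y})"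
    and s: "\<And>z. z \<in> A \<Longrightarrow> s z \<in> A"
    and fs: "\<And>z. z \<in> A \<Longrightarrow> f (s z) = skip_rot (rot d) x y (f z)"
    and cn: "\<And>\<iota>. pairing A \<iota> \<Longrightarrow>
       vconn V (darts V d) fst (add_edge x y (transport A (darts V d - {x, y}) f \<iota>)) \<longleftrightarrow> Q \<iota>"
    and z: "c = (if rot d y = x then 1 else 0) 
       + (if (if rot d x = x then rot d y else rot d x) = y then 1 else 0) + card {v \<in> V. d v = 0}"
  shows "card {\<iota> \<in> cmaps V d. nfaces V d \<iota> = F \<and> \<iota> x = y}
       = card {\<iota>. pairing A \<iota> \<and> Q \<iota> \<and> card (orb (s \<circ> \<iota>) ` A) + c = F}"
proof -
  let ?H = "darts V d" and ?H' = "darts V d - {x, y}"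
  let ?T = "transport A ?H' f"
  have bij: "bij_betw (add_edge x y \<circ> ?T) {\<iota>. pairing A \<iota>} {\<iota>. pairing ?H \<iota> \<and> \<iota> x = y}"
    by (rule bij_betw_trans[OF bij_transport[OF f] bij_add_edge[OF xy]])
  have "card {\<iota> \<in> {\<iota>. pairing A \<iota>}. Q \<iota> \<and> card (orb (s \<circ> \<iota>) ` A) + c = F}
     = card {\<iota> \<in> {\<iota>. pairing ?H \<iota> \<and> \<iota> x = y}. vconn V ?H fst \<iota> \<and> nfaces V d \<iota> = F}"
  proof (rule card_restricted_bij[OF bij])
    fix \<iota> assume "\<iota> \<in> {\<iota>. pairing A \<iota>}"
    then have \<iota>: "pairing A \<iota>" by simp
    have "card (orb (rot d \<circ> add_edge x y (?T \<iota>)) ` ?H) + card {v \<in> V. d v = 0}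
        = card (orb (skip_rot (rot d) x y \<circ> ?T \<iota>) ` ?H') + c"
      using card_orbs_add_edge[OF finite_darts[OF fin] rot_inj rot_into xy pairing_transport[OF f \<iota>]] z
      by simp
    also have "card (orb (skip_rot (rot d) x y \<circ> ?T \<iota>) ` ?H') = card (orb (s \<circ> \<iota>) ` A)"
      by (rule card_orbs_transport[OF f \<iota>]) (use s fs in auto)
    finally have "nfaces V d (add_edge x y (?T \<iota>)) = card (orb (s \<circ> \<iota>) ` A) + c"
      unfolding nfaces_def .
    then show "(Q \<iota> \<and> card (orb (s \<circ> \<iota>) ` A) + c = F) \<longleftrightarrow>
       (vconn V ?H fst ((add_edge x y \<circ> ?T) \<iota>) \<and> nfaces V d ((add_edge x y \<circ> ?T) \<iota>) = F)"
      using cn[OF \<iota>] by simp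
  qed
  then show ?thesis
    by (simp add: cmaps_def conj_commute conj_left_commute conj_assoc)
qed

subsection \<open>Contracting an edge and cutting a loop\<close>

text \<open>A further edge imposes one further condition on a closed set: it contains both ends or
  neither. For a loop this condition is void.\<close>

lemma closed_under_add_edge:
  assumes xy: "x \<in> H" "y \<in> H" "x \<noteq> y" and \<iota>: "pairing (H - {x, y}) \<iota>"
  shows "closed_under H p (add_edge x y \<iota>) S \<longleftrightarrow>
    (p x \<in> S \<longleftrightarrow> p y \<in> S) \<and> closed_under (H - {x, y}) p \<iota> S"
proof -
  have H: "H = insert x (insert y (H - {x, y}))" using xy by auto
  have "closed_under H p (add_edge x y \<iota>) S \<longleftrightarrow>
    (p x \<in> S \<longleftrightarrow> p y \<in> S) \<and> (\<forall>h\<in>H - {x, y}. p h \<in> S \<longrightarrow> p (add_edge x y \<iota> h) \<in> S)"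
    unfolding closed_under_def using xy by (subst H) (auto simp: add_edge_def)
  then show ?thesis by (simp add: closed_under_def add_edge_def)
qed

lemma conn_add_loop:
  assumes "x \<in> H" "y \<in> H" "x \<noteq> y" "pairing (H - {x, y}) \<iota>" "p x = p y"
  shows "vconn V H p (add_edge x y \<iota>) \<longleftrightarrow> vconn V (H - {x, y}) p \<iota>"
  unfolding vconn_def closed_under_add_edge[OF assms(1-4)] using assms(5) by simp

text \<open>Subsets of \<open>V\<close> that treat \<open>v\<close> and \<open>w\<close> alike
  correspond to subsets of \<open>V - {w}\<close> by forgetting \<open>w\<close>; these are the sets
  that matter on the two sides.\<close>

lemma conn_add_edge:
  assumes xy: "x \<in> H" "y \<in> H" "x \<noteq> y" and \<iota>: "pairing (H - {x, y}) \<iota>"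
    and p: "p x = v" "p y = w" "v \<noteq> w" "v \<in> V" "w \<in> V"
  shows "vconn V H p (add_edge x y \<iota>) \<longleftrightarrow> vconn (V - {w}) (H - {x, y}) (id(w := v) \<circ> p) \<iota>"
proof -
  have cl: "closed_under (H - {x, y}) (id(w := v) \<circ> p) \<iota> (S - {w}) \<longleftrightarrow> closed_under (H - {x, y}) p \<iota> S"
    if "v \<in> S \<longleftrightarrow> w \<in> S" for S
  proof -
    have "(id(w := v) \<circ> p) h \<in> S - {w} \<longleftrightarrow> p h \<in> S" for h using that p by auto
    then show ?thesis unfolding closed_under_def by simp
  qed
  show ?thesis
  proof
    assume L: "vconn V H p (add_edge x y \<iota>)"
    have "S = V - {w}" if S: "S \<subseteq> V - {w}" "S \<noteq> {}"
      "closed_under (H - {x, y}) (id(w := v) \<circ> p) \<iota> S" for S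
    proof -
      \<comment> \<open>Undo the identification: \<open>w\<close> is put back exactly when
        \<open>v\<close> is present.\<close>
      define T where "T = (if v \<in> S then insert w S else S)"
      have T: "v \<in> T \<longleftrightarrow> w \<in> T" "T - {w} = S" using S p by (auto simp: T_def)
      have "closed_under H p (add_edge x y \<iota>) T"
        unfolding closed_under_add_edge[OF xy \<iota>] using T cl[OF T(1)] S(3) p by simp
      moreover have "T \<subseteq> V" "T \<noteq> {}" using S p by (auto simp: T_def)
      ultimately have "T = V" using L unfolding vconn_def by blast
      then show ?thesis using T by simp
    qed
    then show "vconn (V - {w}) (H - {x, y}) (id(w := v) \<circ> p) \<iota>" using p unfolding vconn_def by blast
  next
    assume R: "vconn (V - {w}) (H - {x, y}) (id(w := v) \<circ> p) \<iota>"
    have "S = V" if S: "S \<subseteq> V" "S \<noteq> {}" "closed_under H p (add_edge x y \<iota>) S" for S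
    proof -
      have T: "v \<in> S \<longleftrightarrow> w \<in> S" "closed_under (H - {x, y}) p \<iota> S"
        using S(3) p unfolding closed_under_add_edge[OF xy \<iota>] by auto
      have "S - {w} \<subseteq> V - {w}" "S - {w} \<noteq> {}" using S T p by auto
      then have "S - {w} = V - {w}" using R cl[OF T(1)] T(2) unfolding vconn_def by blast
      then show ?thesis using T(1) p by auto
    qed
    then show "vconn V H p (add_edge x y \<iota>)" using p unfolding vconn_def by blast
  qed
qed

text \<open>The cyclic order at the merged vertex: first the half-edges of \<open>v\<close> after the root, then those of
  \<open>w\<close> starting after the deleted half-edge \<open>k\<close>.\<close>
definition merge_emb :: "('v \<Rightarrow> nat) \<Rightarrow> 'v \<Rightarrow> 'v \<Rightarrow> nat \<Rightarrow> 'v \<times> nat \<Rightarrow> 'v \<times> nat" where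
  "merge_emb d v w k = (\<lambda>(u, t). if u \<noteq> v then (u, t) else if Suc t < d v then (v, Suc t)
     else (w, if k + 2 + t - d v < d w then k + 2 + t - d v else k + 2 + t - d v - d w))"

lemma bij_merge_emb:
  assumes vw: "v \<in> V" "w \<in> V" "v \<noteq> w" "0 < d v" "k < d w"
  shows "bij_betw (merge_emb d v w k) (darts (V - {w}) (d(v := d v + d w - 2))) (darts V d - {(v, 0), (w, k)})"
    (is "bij_betw ?f ?A ?B")
proof (rule bij_betw_byWitness)
  \<comment> \<open>At \<open>w\<close> the position is the cyclic distance from the deleted dart
    \<open>k\<close>, less one, after the \<open>d v - 1\<close> darts that come from
    \<open>v\<close>.\<close>
  let ?g = "\<lambda>(u, t). if u = v then (v, t - 1)
        else if u = w then (v, d v - 1 + (if k < t then t - k - 1 else t + d w - k - 1)) else (u, t)"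
  have e1: "?f (v, t) = (v, Suc t)" if "Suc t < d v" for t
    using that by (simp add: merge_emb_def)
  \<comment> \<open>Writing the index as \<open>d v - 1 + r\<close> removes the truncated
    subtraction: \<open>r\<close> counts the darts of \<open>w\<close> from the successor of
    \<open>k\<close> on.\<close>
  have e2: "?f (v, d v - 1 + r) = (w, if Suc (k + r) < d w then Suc (k + r) else Suc (k + r) - d w)" for r
  proof -
    have "k + 2 + (d v - 1 + r) - d v = Suc (k + r)" using vw by simp
    then show ?thesis using vw by (simp add: merge_emb_def)
  qed
  have f: "?f (u, t) \<in> ?B \<and> ?g (?f (u, t)) = (u, t)" if ut: "(u, t) \<in> ?A" for u t
  proof (cases "u = v")
    case False
    then show ?thesis using ut by (simp add: merge_emb_def mem_darts)
  next
    case u: True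
    then have t: "t < d v + d w - 2" using ut by (simp add: mem_darts)
    show ?thesis
    proof (cases "Suc t < d v")
      case True
      then show ?thesis using vw unfolding u e1[OF True] by (simp add: mem_darts)
    next
      case False
      define r where "r = t - (d v - 1)"
      have r: "t = d v - 1 + r" "Suc r < d w" using False t vw by (auto simp: r_def)
      show ?thesis unfolding u r(1) e2 using vw r(2)
        by (cases "Suc (k + r) < d w") (auto simp: mem_darts)
    qed
  qed
  have g: "?g (u, t) \<in> ?A \<and> ?f (?g (u, t)) = (u, t)" if ut: "(u, t) \<in> ?B" for u t
  proof (cases "u = v")
    case True
    then have "0 < t" "t < d v" using ut by (auto simp: mem_darts)
    then show ?thesis using True vw e1[of "t - 1"] by (simp add: mem_darts)
  next
    case uv: False
    show ?thesis
    proof (cases "u = w")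
      case True
      then have t: "t < d w" "t \<noteq> k" using ut by (auto simp: mem_darts)
      define r where "r = (if k < t then t - k - 1 else t + d w - k - 1)"
      have "?g (u, t) = (v, d v - 1 + r)" using True vw by (simp add: r_def)
      moreover have "Suc r < d w" using t vw by (auto simp: r_def)
      moreover have "(if Suc (k + r) < d w then Suc (k + r) else Suc (k + r) - d w) = t"
        using t vw by (auto simp: r_def)
      ultimately show ?thesis using True vw by (simp only: e2) (simp add: mem_darts)
    next
      case False
      then show ?thesis using ut uv by (simp add: merge_emb_def mem_darts)
    qed
  qed
  note f' = f[of "fst z" "snd z" for z, unfolded prod.collapse]
  note g' = g[of "fst z" "snd z" for z, unfolded prod.collapse]
  show "\<forall>z\<in>?A. ?g (?f z) = z" by (rule ballI) (rule f'[THEN conjunct2])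
  show "\<forall>z\<in>?B. ?f (?g z) = z" by (rule ballI) (rule g'[THEN conjunct2])
  show "?f ` ?A \<subseteq> ?B" by (rule image_subsetI) (rule f'[THEN conjunct1])
  show "?g ` ?B \<subseteq> ?A" by (rule image_subsetI) (rule g'[THEN conjunct1])
qed

text \<open>Skipping the two ends splices the cycles: the last dart of \<open>v\<close> is followed
  by the successor of \<open>(w, k)\<close>, and the dart of \<open>w\<close> before
  \<open>k\<close> by the successor of the root. If one of the vertices has degree 1, the detour at
  its end leads straight to the other one.\<close>

lemma merge_emb_rot:
  assumes vw: "v \<noteq> w" "0 < d v" "k < d w" and z: "z \<in> darts (V - {w}) (d(v := d v + d w - 2))"
  shows "merge_emb d v w k (rot (d(v := d v + d w - 2)) z) = skip_rot (rot d) (v, 0) (w, k) (merge_emb d v w k z)"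
proof -
  obtain u t where ut: "z = (u, t)" by (cases z)
  show ?thesis
  proof (cases "u = v")
    case False
    then show ?thesis using z by (simp add: ut merge_emb_def darts_def skip_rot_def rot_def Let_def)
  next
    case True
    then have t: "t < d v + d w - 2" using z by (simp add: ut darts_def)
    show ?thesis
    proof (cases "Suc t < d v")
      case l: True
      show ?thesis
      proof (cases "Suc (Suc t) = d v")
        case True
        then show ?thesis using l t vw \<open>u = v\<close>
          by (cases "d w = 1") (auto simp: ut merge_emb_def skip_rot_def rot_def Let_def)
      next
        case False
        then show ?thesis using l t vw \<open>u = v\<close>
          by (simp add: ut merge_emb_def skip_rot_def rot_def Let_def)
      qed
    next
      case False
      \<comment> \<open>\<open>s\<close> is the index at \<open>w\<close> before reduction modulo
        \<open>d w\<close>, running from \<open>k + 1\<close> to \<open>k + d w - 1\<close>;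
        \<open>e\<close> below is the reduced index.\<close>
      define s where "s = k + 2 + t - d v"
      have s: "k < s" "s < k + d w" "t = s + d v - (k + 2)" using False t vw by (auto simp: s_def)
      define e where "e = (if s < d w then s else s - d w)"
      have f: "merge_emb d v w k z = (w, e)"
        using False vw \<open>u = v\<close> by (simp add: ut merge_emb_def s_def e_def)
      show ?thesis
      \<comment> \<open>This is the dart just before the deleted one, hence the last dart of the
        merged vertex, where its rotation returns to index 0.\<close>
      proof (cases "Suc s = k + d w")
        case True
        then have "Suc t = d v + d w - 2" using s vw by simp
        moreover have "rot d (w, e) = (w, k)" using True s vw by (auto simp: e_def rot_def)
        ultimately show ?thesis using vw \<open>u = v\<close> unfolding f
          by (auto simp: ut merge_emb_def skip_rot_def rot_def Let_def)
      next
        case ns: False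
        then have "Suc t \<noteq> d v + d w - 2" using s False vw by simp
        moreover have "rot d (w, e) = (w, if Suc s < d w then Suc s else Suc s - d w)" "snd (rot d (w, e)) \<noteq> k"
          using ns s vw by (auto simp: e_def rot_def)
        moreover have "k + 2 + Suc t - d v = Suc s" "\<not> Suc (Suc t) < d v" using False vw by (auto simp: s_def)
        ultimately show ?thesis using vw \<open>u = v\<close> unfolding f
          by (simp add: ut merge_emb_def skip_rot_def Let_def) (auto simp: rot_def)
      qed
    qed
  qed
qed

lemma card_cmaps_merge:
  assumes fin: "finite V" and vw: "v \<in> V" "w \<in> V" "v \<noteq> w" "0 < d v" "k < d w"
  defines "d' \<equiv> d(v := d v + d w - 2)"
  shows "card {\<iota> \<in> cmaps V d. nfaces V d \<iota> = F \<and> \<iota> (v, 0) = (w, k)} 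
       = card {\<iota> \<in> cmaps (V - {w}) d'. nfaces (V - {w}) d' \<iota> = F}"
proof -
  let ?A = "darts (V - {w}) d'" and ?x = "(v, 0::nat)" and ?y = "(w, k)" and ?f = "merge_emb d v w k"
  have xy: "?x \<in> darts V d" "?y \<in> darts V d" "?x \<noteq> ?y" using vw by (auto simp: mem_darts)
  have f: "bij_betw ?f ?A (darts V d - {?x, ?y})"
    unfolding d'_def by (rule bij_merge_emb[OF vw])
  have cn: "vconn V (darts V d) fst (add_edge ?x ?y (transport ?A (darts V d - {?x, ?y}) ?f \<iota>))
      \<longleftrightarrow> vconn (V - {w}) ?A fst \<iota>" if \<iota>: "pairing ?A \<iota>" for \<iota>
  proof -
    have "vconn V (darts V d) fst (add_edge ?x ?y (transport ?A (darts V d - {?x, ?y}) ?f \<iota>))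
      \<longleftrightarrow> vconn (V - {w}) (darts V d - {?x, ?y}) (id(w := v) \<circ> fst) (transport ?A (darts V d - {?x, ?y}) ?f \<iota>)"
      by (rule conn_add_edge[OF xy pairing_transport[OF f \<iota>]]) (use vw in auto)
    also have "\<dots> \<longleftrightarrow> vconn (V - {w}) ?A fst \<iota>"
      by (rule conn_transport[OF f \<iota>, where r = id]) (use vw in \<open>auto simp: merge_emb_def darts_def split: if_splits\<close>)
    finally show ?thesis .
  qed
  \<comment> \<open>The merged vertex is isolated exactly when both ends had degree 1. Then the
    second correction term records a lost face; the first is 0 because the ends lie at different
    vertices.\<close>
  have "{u \<in> V - {w}. d' u = 0} = {u \<in> V. d u = 0} \<union> (if d v = 1 \<and> d w = 1 then {v} else {})"
    using vw by (auto simp: d'_def)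
  moreover have "v \<notin> {u \<in> V. d u = 0}" using vw by simp
  ultimately have c: "card {u \<in> V - {w}. d' u = 0} = (if rot d ?y = ?x then 1 else 0)
       + (if (if rot d ?x = ?x then rot d ?y else rot d ?x) = ?y then 1 else 0) + card {u \<in> V. d u = 0}"
    using fin vw by (auto simp: rot_def)
  show ?thesis
    using rot_into[of d' "V - {w}"]
    by (subst card_delete_edge[OF fin xy f _ _ cn c, of "rot d'" F, OF _ merge_emb_rot[OF vw(3-5), folded d'_def]])
      (auto simp: cmaps_def nfaces_def conj_assoc)
qed

text \<open>The loop joins the darts 0 and \<open>Suc a\<close>. The \<open>a\<close> darts between
  its ends stay at \<open>v\<close> and the remaining ones move to the new vertex \<open>n\<close>,
  which explains the offsets 1 and \<open>a + 2\<close>.\<close>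

definition split_emb :: "'v \<Rightarrow> 'v \<Rightarrow> nat \<Rightarrow> 'v \<times> nat \<Rightarrow> 'v \<times> nat" where
  "split_emb v n a = (\<lambda>(u, t). if u = v then (v, Suc t) else if u = n then (v, a + 2 + t) else (u, t))"

lemma bij_split_emb:
  assumes v: "v \<in> V" "n \<notin> V" "a + b + 2 = d v"
  shows "bij_betw (split_emb v n a) (darts (insert n V) (d(v := a, n := b))) (darts V d - {(v, 0), (v, Suc a)})"
    (is "bij_betw ?f ?A ?B")
proof (rule bij_betw_byWitness)
  let ?g = "\<lambda>(u, t). if u = v then (if t \<le> a then (v, t - 1) else (n, t - a - 2)) else (u, t)"
  have vn: "v \<noteq> n" using v by auto
  have f: "?f (u, t) \<in> ?B \<and> ?g (?f (u, t)) = (u, t)" if ut: "(u, t) \<in> ?A" for u t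
  proof (cases "u = v \<or> u = n")
    case True
    then show ?thesis using ut v vn by (elim disjE) (simp_all add: split_emb_def mem_darts)
  next
    case False
    then show ?thesis using ut by (simp add: split_emb_def mem_darts)
  qed
  have g: "?g (u, t) \<in> ?A \<and> ?f (?g (u, t)) = (u, t)" if ut: "(u, t) \<in> ?B" for u t
  proof (cases "u = v")
    case True
    then have t: "0 < t" "t \<noteq> Suc a" "t < a + b + 2" using ut v by (auto simp: mem_darts)
    show ?thesis
      by (cases "t \<le> a") (use t True v vn in \<open>simp_all add: split_emb_def mem_darts\<close>, linarith)
  next
    case False
    then have "u \<noteq> n" using ut v by (auto simp: mem_darts)
    then show ?thesis using False ut by (simp add: split_emb_def mem_darts)
  qed
  note f' = f[of "fst z" "snd z" for z, unfolded prod.collapse]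
  note g' = g[of "fst z" "snd z" for z, unfolded prod.collapse]
  show "\<forall>z\<in>?A. ?g (?f z) = z" by (rule ballI) (rule f'[THEN conjunct2])
  show "\<forall>z\<in>?B. ?f (?g z) = z" by (rule ballI) (rule g'[THEN conjunct2])
  show "?f ` ?A \<subseteq> ?B" by (rule image_subsetI) (rule f'[THEN conjunct1])
  show "?g ` ?B \<subseteq> ?A" by (rule image_subsetI) (rule g'[THEN conjunct1])
qed

text \<open>Skipping the ends of the loop closes each of the two arcs into a cycle: the dart before
  \<open>Suc a\<close> is followed by dart 1, and the last dart by \<open>a + 2\<close>.\<close>

lemma split_emb_rot:
  assumes v: "v \<in> V" "n \<notin> V" "a + b + 2 = d v" and z: "z \<in> darts (insert n V) (d(v := a, n := b))"
  shows "split_emb v n a (rot (d(v := a, n := b)) z) = skip_rot (rot d) (v, 0) (v, Suc a) (split_emb v n a z)"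
proof -
  obtain u t where ut: "z = (u, t)" by (cases z)
  have vn: "v \<noteq> n" using v by auto
  have dv: "d v = a + b + 2" using v by simp
  consider "u = v" | "u = n" | "u \<noteq> v" "u \<noteq> n" by blast
  then show ?thesis
  proof cases
    case 1
    then have "t < a" using z vn by (simp add: ut mem_darts)
    then show ?thesis using 1 vn dv
      by (cases "Suc t = a") (simp_all add: ut split_emb_def skip_rot_def rot_def Let_def)
  next
    case 2
    then have "t < b" using z vn by (simp add: ut mem_darts)
    then show ?thesis using 2 vn dv
      by (cases "Suc t = b"; cases "a = 0") (simp_all add: ut split_emb_def skip_rot_def rot_def Let_def)
  next
    case 3
    then show ?thesis by (simp add: ut split_emb_def skip_rot_def rot_def Let_def)
  qed
qed

text \<open>Cutting may disconnect the map, so the condition that survives is connectedness with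
  \<open>n\<close> glued back to \<open>v\<close>, expressed by
  \<open>id(n := v) \<circ> fst\<close>. It is resolved into cases separately.\<close>

lemma card_cmaps_split:
  assumes fin: "finite V" and v: "v \<in> V" "n \<notin> V" "a + b + 2 = d v"
  defines "d' \<equiv> d(v := a, n := b)"
  shows "card {\<iota> \<in> cmaps V d. nfaces V d \<iota> = F \<and> \<iota> (v, 0) = (v, Suc a)} 
       = card {\<iota>. pairing (darts (insert n V) d') \<iota> \<and> vconn V (darts (insert n V) d') (id(n := v) \<circ> fst) \<iota>
           \<and> nfaces (insert n V) d' \<iota> = F}"
proof -
  let ?A = "darts (insert n V) d'" and ?x = "(v, 0::nat)" and ?y = "(v, Suc a)" and ?f = "split_emb v n a"
  have xy: "?x \<in> darts V d" "?y \<in> darts V d" "?x \<noteq> ?y" using v by (auto simp: mem_darts)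
  have f: "bij_betw ?f ?A (darts V d - {?x, ?y})"
    unfolding d'_def by (rule bij_split_emb[of v V n a b d, OF v])
  have cn: "vconn V (darts V d) fst (add_edge ?x ?y (transport ?A (darts V d - {?x, ?y}) ?f \<iota>))
      \<longleftrightarrow> vconn V ?A (id(n := v) \<circ> fst) \<iota>" if \<iota>: "pairing ?A \<iota>" for \<iota>
  proof -
    have "vconn V (darts V d) fst (add_edge ?x ?y (transport ?A (darts V d - {?x, ?y}) ?f \<iota>))
      \<longleftrightarrow> vconn V (darts V d - {?x, ?y}) fst (transport ?A (darts V d - {?x, ?y}) ?f \<iota>)"
      by (rule conn_add_loop[OF xy pairing_transport[OF f \<iota>]]) simp
    also have "\<dots> \<longleftrightarrow> vconn V ?A (id(n := v) \<circ> fst) \<iota>"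
      by (rule conn_transport[OF f \<iota>, where r = id]) (use v in \<open>auto simp: split_emb_def darts_def\<close>)
    finally show ?thesis .
  qed
  \<comment> \<open>\<open>b = 0\<close> means that the second end of the loop is followed by the
    root, \<open>a = 0\<close> that the root is followed by the second end. So each new isolated
    vertex replaces one lost face.\<close>
  have "{u \<in> insert n V. d' u = 0} = {u \<in> V. d u = 0} \<union> (if a = 0 then {v} else {}) \<union> (if b = 0 then {n} else {})"
    using v by (auto simp: d'_def)
  moreover have "v \<notin> {u \<in> V. d u = 0}" "n \<notin> {u \<in> V. d u = 0}" "v \<noteq> n" using v by auto
  ultimately have c: "card {u \<in> insert n V. d' u = 0} = (if rot d ?y = ?x then 1 else 0)
       + (if (if rot d ?x = ?x then rot d ?y else rot d ?x) = ?y then 1 else 0) + card {u \<in> V. d u = 0}"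
    using fin v by (auto simp: rot_def)
  show ?thesis
    using rot_into[of d' "insert n V"]
    by (subst card_delete_edge[OF fin xy f _ _ cn c, of "rot d'" F, OF _ split_emb_rot[of v V n a b d, OF v, folded d'_def]])
      (auto simp: nfaces_def)
qed

subsection \<open>Splitting into two components\<close>

lemma closed_under_Int: "closed_under H p \<iota> S \<Longrightarrow> closed_under H p \<iota> T \<Longrightarrow> closed_under H p \<iota> (S \<inter> T)"
  by (auto simp: closed_under_def)

lemma closed_under_Un: "closed_under H p \<iota> S \<Longrightarrow> closed_under H p \<iota> T \<Longrightarrow> closed_under H p \<iota> (S \<union> T)"
  by (auto simp: closed_under_def)

text \<open>Edges can be traversed backwards because a pairing is an involution, so closed sets are
  unions of components.\<close>

lemma closed_under_Diff:
  assumes "pairing H \<iota>" "p ` H \<subseteq> V" "closed_under H p \<iota> S"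
  shows "closed_under H p \<iota> (V - S)"
  unfolding closed_under_def
proof (intro ballI impI)
  fix h assume h: "h \<in> H" "p h \<in> V - S"
  have \<iota>: "\<iota> h \<in> H" "\<iota> (\<iota> h) = h" using assms(1) h by (simp_all add: pairing_def)
  have "p (\<iota> h) \<notin> S" using assms(3) \<iota> h unfolding closed_under_def by force
  then show "p (\<iota> h) \<in> V - S" using \<iota> assms(2) by auto
qed

lemma conn_glue_iff:
  assumes "v \<in> V" "n \<notin> V"
  shows "vconn V H (id(n := v) \<circ> p) \<iota> \<longleftrightarrow>
    (\<forall>S\<subseteq>insert n V. S \<noteq> {} \<longrightarrow> (v \<in> S \<longleftrightarrow> n \<in> S) \<longrightarrow> closed_under H p \<iota> S \<longrightarrow> S = insert n V)"
    (is "?L \<longleftrightarrow> ?R")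
proof -
  have cl: "closed_under H (id(n := v) \<circ> p) \<iota> (S - {n}) \<longleftrightarrow> closed_under H p \<iota> S"
    if "v \<in> S \<longleftrightarrow> n \<in> S" for S
  proof -
    have "(id(n := v) \<circ> p) h \<in> S - {n} \<longleftrightarrow> p h \<in> S" for h using that assms by auto
    then show ?thesis unfolding closed_under_def by simp
  qed
  show ?thesis
  proof
    assume L: ?L
    show ?R
    proof (intro allI impI)
      fix S assume S: "S \<subseteq> insert n V" "S \<noteq> {}" "v \<in> S \<longleftrightarrow> n \<in> S" "closed_under H p \<iota> S"
      then have "S - {n} \<subseteq> V" "S - {n} \<noteq> {}" using assms by auto
      then have "S - {n} = V" using L cl[OF S(3)] S(4) unfolding vconn_def by blast
      then show "S = insert n V" using S assms by auto
    qed
  next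
    assume R: ?R
    have "S = V" if S: "S \<subseteq> V" "S \<noteq> {}" "closed_under H (id(n := v) \<circ> p) \<iota> S" for S
    proof -
      define T where "T = (if v \<in> S then insert n S else S)"
      have T: "v \<in> T \<longleftrightarrow> n \<in> T" "T - {n} = S" using S assms by (auto simp: T_def)
      have "T \<subseteq> insert n V" "T \<noteq> {}" using S by (auto simp: T_def)
      then have "T = insert n V" using R T(1) cl[OF T(1)] S(3) T(2) by auto
      then show ?thesis using T assms by auto
    qed
    then show ?L using assms unfolding vconn_def by blast
  qed
qed

text \<open>Only the component \<open>K\<close> of \<open>v\<close> matters. If it contains
  \<open>n\<close>, the map was connected before gluing; otherwise gluing can connect everything
  only when the complement of \<open>K\<close> is a single component, that of \<open>n\<close>. The
  set \<open>I\<close> is \<open>K\<close> without \<open>v\<close>.\<close>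

lemma conn_glue_cases:
  assumes v: "v \<in> V" "n \<notin> V" and \<iota>: "pairing H \<iota>" and p: "p ` H \<subseteq> insert n V"
  shows "vconn V H (id(n := v) \<circ> p) \<iota> \<longleftrightarrow> vconn (insert n V) H p \<iota> \<or>
    (\<exists>I\<in>Pow (V - {v}). closed_under H p \<iota> (insert v I) \<and> vconn (insert v I) H p \<iota>
       \<and> vconn (insert n (V - {v} - I)) H p \<iota>)"
    (is "?L \<longleftrightarrow> ?A \<or> ?B")
proof -
  let ?V = "insert n V" and ?cl = "closed_under H p \<iota>"
  have compl: "?cl (?V - S)" if "?cl S" for S by (rule closed_under_Diff[OF \<iota> p that])
  show ?thesis unfolding conn_glue_iff[OF v]
  proof (intro iffI)
    assume "\<forall>S\<subseteq>?V. S \<noteq> {} \<longrightarrow> (v \<in> S \<longleftrightarrow> n \<in> S) \<longrightarrow> ?cl S \<longrightarrow> S = ?V"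
    then have L: "S = ?V" if "S \<subseteq> ?V" "S \<noteq> {}" "v \<in> S \<longleftrightarrow> n \<in> S" "?cl S" for S using that by simp
    \<comment> \<open>The least closed set containing \<open>v\<close>, that is, the component of
      \<open>v\<close>, obtained without paths.\<close>
    define K where "K = \<Inter>{S. S \<subseteq> ?V \<and> v \<in> S \<and> ?cl S}"
    have "?cl ?V" using p \<iota> by (auto simp: closed_under_def pairing_def)
    then have KV: "K \<subseteq> ?V" using v unfolding K_def by blast
    have vK: "v \<in> K" by (auto simp: K_def)
    have clK: "?cl K" unfolding K_def closed_under_def by blast
    have Kmin: "K \<subseteq> S" if "S \<subseteq> ?V" "v \<in> S" "?cl S" for S using that unfolding K_def by blast
    show "?A \<or> ?B"
    proof (cases "n \<in> K")
      case True
      have "S = ?V" if S: "S \<subseteq> ?V" "S \<noteq> {}" "?cl S" for S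
      proof (cases "v \<in> S")
        case vS: True
        then have "n \<in> S" using Kmin[OF S(1) vS S(3)] True by blast
        then show ?thesis using L[of S] S vS by simp
      next
        case vS: False
        then have "K \<subseteq> ?V - S" using Kmin[of "?V - S"] compl[OF S(3)] v by blast
        then have "v \<in> ?V - S" "n \<in> ?V - S" using True vK by auto
        then have "?V - S = ?V" by (intro L compl S(3)) auto
        then show ?thesis using S by blast
      qed
      then have ?A unfolding vconn_def by blast
      then show ?thesis ..
    next
      case False
      define I where "I = K - {v}"
      have I: "insert v I = K" "I \<in> Pow (V - {v})" "insert n (V - {v} - I) = ?V - K"
        using vK KV False v by (auto simp: I_def)
      have "S = K" if S: "S \<subseteq> K" "S \<noteq> {}" "?cl S" for S
      proof (cases "v \<in> S")
        case True
        then show ?thesis using Kmin[of S] S KV by blast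
      next
        case vS: False
        have "K \<inter> (?V - S) = K - S" using KV by blast
        then have "?cl (K - S)" using closed_under_Int[OF clK compl[OF S(3)]] by simp
        then have "K \<subseteq> K - S" using Kmin[of "K - S"] KV vK vS by blast
        then show ?thesis using S by blast
      qed
      then have c1: "vconn K H p \<iota>" using vK unfolding vconn_def by blast
      \<comment> \<open>If \<open>n\<close> is in \<open>S\<close>, then \<open>S \<union> K\<close>
        contains both glued vertices. If not, \<open>S\<close> contains neither. In both cases the
        hypothesis on sets that treat \<open>v\<close> and \<open>n\<close> alike applies.\<close>
      have "S = ?V - K" if S: "S \<subseteq> ?V - K" "S \<noteq> {}" "?cl S" for S
      proof (cases "n \<in> S")
        case True
        then have "v \<in> S \<union> K" "n \<in> S \<union> K" "S \<union> K \<subseteq> ?V" using S(1) KV vK by auto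
        then have "S \<union> K = ?V" by (intro L closed_under_Un[OF S(3) clK]) auto
        then show ?thesis using S by blast
      next
        case False
        have "v \<notin> S" "S \<subseteq> ?V" using S vK by auto
        then have "S = ?V" using L S False by simp
        then show ?thesis using False by simp
      qed
      then have "vconn (?V - K) H p \<iota>" using False unfolding vconn_def by blast
      then show ?thesis using c1 clK I by (metis (no_types, lifting))
    qed
  next
    assume "?A \<or> ?B"
    then show "\<forall>S\<subseteq>?V. S \<noteq> {} \<longrightarrow> (v \<in> S \<longleftrightarrow> n \<in> S) \<longrightarrow> ?cl S \<longrightarrow> S = ?V"
    proof
      assume ?A
      then show ?thesis unfolding vconn_def by blast
    next
      assume ?B
      then obtain I where I: "I \<subseteq> V - {v}" "?cl (insert v I)" "vconn (insert v I) H p \<iota>"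
        "vconn (insert n (V - {v} - I)) H p \<iota>" by blast
      define K where "K = insert v I"
      have L: "insert n (V - {v} - I) = ?V - K" using I v by (auto simp: K_def)
      have K: "?cl K" "K \<subseteq> ?V" "v \<in> K" "n \<notin> K" using I v by (auto simp: K_def)
      have c1: "S = K" if "S \<subseteq> K" "S \<noteq> {}" "?cl S" for S
        using I(3) that unfolding vconn_def K_def by blast
      have c2: "S = ?V - K" if "S \<subseteq> ?V - K" "S \<noteq> {}" "?cl S" for S
        using I(4) that unfolding vconn_def L by blast
      show ?thesis
      proof (intro allI impI)
        fix S assume S: "S \<subseteq> ?V" "S \<noteq> {}" "v \<in> S \<longleftrightarrow> n \<in> S" "?cl S"
        \<comment> \<open>A closed set contains each of the two components or misses it, and the
          gluing condition forces the same choice for both.\<close>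
        have a: "S \<inter> K = {} \<or> S \<inter> K = K" using c1[of "S \<inter> K"] closed_under_Int[OF S(4) K(1)] by blast
        have b: "S \<inter> (?V - K) = {} \<or> S \<inter> (?V - K) = ?V - K"
          using c2[of "S \<inter> (?V - K)"] closed_under_Int[OF S(4) compl[OF K(1)]] by blast
        show "S = ?V"
        proof (cases "v \<in> S")
          case True
          then have "S \<inter> K = K" "S \<inter> (?V - K) = ?V - K" using a b S(3) K by auto
          then show ?thesis using S(1) by blast
        next
          case False
          then have "S \<inter> K = {}" "S \<inter> (?V - K) = {}" using a b S(3) K by auto
          then show ?thesis using S(1,2) by blast
        qed
      qed
    qed
  qed
qed

lemma conn_closed_unique:
  assumes "vconn K H p \<iota>" "vconn L H p \<iota>" "closed_under H p \<iota> K" "closed_under H p \<iota> L" "v \<in> K" "v \<in> L"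
  shows "K = L"
proof -
  have "closed_under H p \<iota> (K \<inter> L)" "K \<inter> L \<noteq> {}" using assms closed_under_Int by auto
  then have "K \<inter> L = K" "K \<inter> L = L" using vconnD assms(1,2) by (metis Int_lower1, metis Int_lower2)
  then show ?thesis by simp
qed

section \<open>Maps with two prescribed components\<close>

lemma darts_Un: "darts (K \<union> L) d = darts K d \<union> darts L d"
  by (auto simp: darts_def)

lemma nfaces_Un:
  assumes fin: "finite K" "finite L" and disj: "K \<inter> L = {}"
    and x: "pairing (darts K d) x" and y: "pairing (darts L d) y"
    and e: "\<And>h. h \<in> darts K d \<Longrightarrow> \<iota> h = x h" "\<And>h. h \<in> darts L d \<Longrightarrow> \<iota> h = y h"
  shows "nfaces (K \<union> L) d \<iota> = nfaces K d x + nfaces L d y"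
proof -
  have D: "darts K d \<inter> darts L d = {}" using disj by (auto simp: darts_def)
  have cx: "(rot d \<circ> x) h \<in> darts K d" "(rot d \<circ> \<iota>) h = (rot d \<circ> x) h" if "h \<in> darts K d" for h
    using that x e(1) rot_into[of d K] by (auto simp: pairing_def)
  have cy: "(rot d \<circ> y) h \<in> darts L d" "(rot d \<circ> \<iota>) h = (rot d \<circ> y) h" if "h \<in> darts L d" for h
    using that y e(2) rot_into[of d L] by (auto simp: pairing_def)
  have "card (orb (rot d \<circ> \<iota>) ` (darts K d \<union> darts L d))
      = card (orb (rot d \<circ> \<iota>) ` darts K d) + card (orb (rot d \<circ> \<iota>) ` darts L d)"
    using cx cy fin by (intro card_orbs_Un finite_darts D) (auto simp: image_subset_iff)
  moreover have "orb (rot d \<circ> \<iota>) ` darts K d = orb (rot d \<circ> x) ` darts K d"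
    by (rule image_cong[OF refl], rule orb_cong[where H = "darts K d"]) (use cx in auto)
  moreover have "orb (rot d \<circ> \<iota>) ` darts L d = orb (rot d \<circ> y) ` darts L d"
    by (rule image_cong[OF refl], rule orb_cong[where H = "darts L d"]) (use cy in auto)
  moreover have "{v \<in> K \<union> L. d v = 0} = {v \<in> K. d v = 0} \<union> {v \<in> L. d v = 0}" by auto
  then have "card {v \<in> K \<union> L. d v = 0} = card {v \<in> K. d v = 0} + card {v \<in> L. d v = 0}"
    using fin disj by (simp add: card_Un_disjoint disjoint_iff)
  ultimately show ?thesis by (simp add: nfaces_def darts_Un)
qed

lemma conn_restrict:
  assumes "K \<subseteq> V" "\<And>h. h \<in> darts K d \<Longrightarrow> \<iota> h = x h"
  shows "vconn K (darts V d) fst \<iota> \<longleftrightarrow> vconn K (darts K d) fst x"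
proof -
  have "closed_under (darts V d) fst \<iota> S \<longleftrightarrow> closed_under (darts K d) fst x S" if "S \<subseteq> K" for S
  proof -
    have "h \<in> darts V d \<and> fst h \<in> S \<longleftrightarrow> h \<in> darts K d \<and> fst h \<in> S" for h
      using that assms(1) by (auto simp: darts_def)
    then show ?thesis unfolding closed_under_def using assms(2) by metis
  qed
  then show ?thesis unfolding vconn_def by blast
qed

definition restrict_pairing :: "'a set \<Rightarrow> ('a \<Rightarrow> 'a) \<Rightarrow> 'a \<Rightarrow> 'a" where
  "restrict_pairing H \<iota> = (\<lambda>h. if h \<in> H then \<iota> h else h)"

lemma pairing_restr:
  assumes "pairing H \<iota>" "A \<subseteq> H" "\<iota> ` A \<subseteq> A"
  shows "pairing A (restrict_pairing A \<iota>)"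
proof -
  have "\<iota> h \<in> A" "\<iota> (\<iota> h) = h" "\<iota> h \<noteq> h" if "h \<in> A" for h
    using assms that by (auto simp: pairing_def)
  then show ?thesis by (simp add: pairing_def restrict_pairing_def)
qed

definition num_split_maps :: "'v set \<Rightarrow> 'v set \<Rightarrow> ('v \<Rightarrow> nat) \<Rightarrow> nat \<Rightarrow> nat" where
  "num_split_maps K L d F = card {(x, y) \<in> cmaps K d \<times> cmaps L d. nfaces K d x + nfaces L d y = F}"

text \<open>Restriction to the two dart sets and overlaying are mutually inverse. Closedness of
  \<open>L\<close>, which makes the second restriction a pairing, comes from that of
  \<open>K\<close> by complementation.\<close>

lemma card_disconnected:
  assumes fin: "finite K" "finite L" and disj: "K \<inter> L = {}"
  shows "card {\<iota>. pairing (darts (K \<union> L) d) \<iota> \<and> closed_under (darts (K \<union> L) d) fst \<iota> K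
     \<and> vconn K (darts (K \<union> L) d) fst \<iota> \<and> vconn L (darts (K \<union> L) d) fst \<iota> \<and> nfaces (K \<union> L) d \<iota> = F}
    = num_split_maps K L d F"
  (is "card ?X = _")
proof -
  let ?H = "darts (K \<union> L) d" and ?A = "darts K d" and ?B = "darts L d"
  let ?Y = "{(x, y) \<in> cmaps K d \<times> cmaps L d. nfaces K d x + nfaces L d y = F}"
  have H: "?H = ?A \<union> ?B" by (rule darts_Un)
  have D: "?A \<inter> ?B = {}" using disj by (auto simp: darts_def)
  define to where "to \<iota> = (restrict_pairing ?A \<iota>, restrict_pairing ?B \<iota>)" for \<iota> :: "'a \<times> nat \<Rightarrow> 'a \<times> nat"
  define fr where "fr = (\<lambda>(x, y) h. if h \<in> ?A then x h else if h \<in> ?B then y h else h)"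
    for h :: "'a \<times> nat"
  have "bij_betw to ?X ?Y"
  proof (rule bij_betw_byWitness[where f' = fr])
    show "\<forall>\<iota>\<in>?X. fr (to \<iota>) = \<iota>"
      using H by (auto simp: to_def fr_def restrict_pairing_def fun_eq_iff pairing_def)
    show "\<forall>xy\<in>?Y. to (fr xy) = xy"
    proof clarify
      fix x y assume "x \<in> cmaps K d" "y \<in> cmaps L d"
      then have x: "pairing ?A x" and y: "pairing ?B y" by (auto simp: cmaps_def)
      have "restrict_pairing ?A (fr (x, y)) h = x h" for h
        using pairing_outside[OF x] by (simp add: restrict_pairing_def fr_def)
      moreover have "restrict_pairing ?B (fr (x, y)) h = y h" for h
        using pairing_outside[OF y] D by (auto simp: restrict_pairing_def fr_def)
      ultimately show "to (fr (x, y)) = (x, y)" by (auto simp: to_def)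
    qed
    show "to ` ?X \<subseteq> ?Y"
    proof (rule image_subsetI)
      fix \<iota> assume "\<iota> \<in> ?X"
      then have \<iota>: "pairing ?H \<iota>" "closed_under ?H fst \<iota> K" "vconn K ?H fst \<iota>" "vconn L ?H fst \<iota>"
        "nfaces (K \<union> L) d \<iota> = F" by auto
      have clL: "closed_under ?H fst \<iota> (K \<union> L - K)"
        by (rule closed_under_Diff[OF \<iota>(1) _ \<iota>(2)]) (auto simp: darts_def)
      have "K \<union> L - K = L" using disj by auto
      note clL = clL[unfolded this]
      have into: "\<iota> ` darts S d \<subseteq> darts S d" if "closed_under ?H fst \<iota> S" "S \<subseteq> K \<union> L" for S
      proof (rule image_subsetI)
        fix h assume h: "h \<in> darts S d"
        then have "h \<in> ?H" "fst h \<in> S" using that(2) by (auto simp: darts_def)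
        then have "\<iota> h \<in> ?H" "fst (\<iota> h) \<in> S" using \<iota>(1) that(1) by (auto simp: pairing_def closed_under_def)
        then show "\<iota> h \<in> darts S d" by (auto simp: darts_def)
      qed
      have px: "pairing ?A (restrict_pairing ?A \<iota>)" by (rule pairing_restr[OF \<iota>(1) _ into[OF \<iota>(2)]]) (auto simp: H)
      have py: "pairing ?B (restrict_pairing ?B \<iota>)" by (rule pairing_restr[OF \<iota>(1) _ into[OF clL]]) (auto simp: H)
      have "vconn K ?A fst (restrict_pairing ?A \<iota>)"
        using \<iota>(3) conn_restrict[of K "K \<union> L" d \<iota> "restrict_pairing ?A \<iota>"] by (simp add: restrict_pairing_def)
      moreover have "vconn L ?B fst (restrict_pairing ?B \<iota>)"
        using \<iota>(4) conn_restrict[of L "K \<union> L" d \<iota> "restrict_pairing ?B \<iota>"] by (simp add: restrict_pairing_def)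
      moreover have "nfaces (K \<union> L) d \<iota> = nfaces K d (restrict_pairing ?A \<iota>) + nfaces L d (restrict_pairing ?B \<iota>)"
        by (rule nfaces_Un[OF fin disj px py]) (auto simp: restrict_pairing_def)
      ultimately show "to \<iota> \<in> ?Y" using px py \<iota>(5) by (simp add: to_def cmaps_def)
    qed
    show "fr ` ?Y \<subseteq> ?X"
    proof (rule image_subsetI)
      fix xy assume "xy \<in> ?Y"
      then obtain x y where xy: "xy = (x, y)" "x \<in> cmaps K d" "y \<in> cmaps L d"
        and F: "nfaces K d x + nfaces L d y = F" by blast
      then have x: "pairing ?A x" "vconn K ?A fst x" and y: "pairing ?B y" "vconn L ?B fst y"
        by (auto simp: cmaps_def)
      let ?\<iota> = "fr (x, y)"
      have eA: "?\<iota> h = x h" if "h \<in> ?A" for h using that by (simp add: fr_def)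
      have eB: "?\<iota> h = y h" if "h \<in> ?B" for h using that D by (auto simp: fr_def)
      have eN: "?\<iota> h = h" if "h \<notin> ?H" for h using that by (simp add: fr_def H)
      have xA: "x h \<in> ?A" "x (x h) = h" "x h \<noteq> h" if "h \<in> ?A" for h using x that by (simp_all add: pairing_def)
      have yB: "y h \<in> ?B" "y (y h) = h" "y h \<noteq> h" if "h \<in> ?B" for h using y that by (simp_all add: pairing_def)
      have "?\<iota> h \<in> ?H \<and> ?\<iota> (?\<iota> h) = h \<and> ?\<iota> h \<noteq> h" if h: "h \<in> ?H" for h
      proof (cases "h \<in> ?A")
        case True
        then show ?thesis using xA[OF True] by (simp add: eA H)
      next
        case False
        then have "h \<in> ?B" using h H by blast
        then show ?thesis using yB[OF \<open>h \<in> ?B\<close>] by (simp add: eB H)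
      qed
      then have p: "pairing ?H ?\<iota>" using eN by (simp add: pairing_def)
      have "closed_under ?H fst ?\<iota> K"
        unfolding closed_under_def
      proof (intro ballI impI)
        fix h assume h: "h \<in> ?H" "fst h \<in> K"
        then have "h \<in> ?A" by (auto simp: darts_def)
        then have "?\<iota> h \<in> ?A" using xA by (simp add: eA)
        then show "fst (?\<iota> h) \<in> K" by (auto simp: darts_def)
      qed
      moreover have "vconn K ?H fst ?\<iota>" using conn_restrict[of K "K \<union> L" d ?\<iota> x] eA x(2) by simp
      moreover have "vconn L ?H fst ?\<iota>" using conn_restrict[of L "K \<union> L" d ?\<iota> y] eB y(2) by simp
      moreover have "nfaces (K \<union> L) d ?\<iota> = nfaces K d x + nfaces L d y"
        by (rule nfaces_Un[OF fin disj x(1) y(1) eA eB])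
      ultimately show "fr xy \<in> ?X" using p F by (simp add: xy(1))
    qed
  qed
  then show ?thesis unfolding num_split_maps_def by (rule bij_betw_same_card)
qed

section \<open>The recursion for a fixed number of faces\<close>

definition num_maps :: "'v set \<Rightarrow> ('v \<Rightarrow> nat) \<Rightarrow> nat \<Rightarrow> nat" where
  "num_maps V d F = card {\<iota> \<in> cmaps V d. nfaces V d \<iota> = F}"

text \<open>The vertices \<open>v\<close> and \<open>n\<close> tell the two components apart, so the
  partitions that occur are ordered. Uniqueness of the component of \<open>v\<close> makes the
  classes for different \<open>I\<close> disjoint.\<close>

lemma card_glued:
  assumes fin: "finite V" and v: "v \<in> V" "n \<notin> V"
  shows "card {\<iota>. pairing (darts (insert n V) d) \<iota> \<and> vconn V (darts (insert n V) d) (id(n := v) \<circ> fst) \<iota>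
           \<and> nfaces (insert n V) d \<iota> = F}
    = num_maps (insert n V) d F + (\<Sum>I\<in>Pow (V - {v}). num_split_maps (insert v I) (insert n (V - {v} - I)) d F)"
proof -
  let ?V = "insert n V"
  let ?H = "darts ?V d"
  define X where "X I = {\<iota>. pairing ?H \<iota> \<and> closed_under ?H fst \<iota> (insert v I) \<and> vconn (insert v I) ?H fst \<iota>
     \<and> vconn (insert n (V - {v} - I)) ?H fst \<iota> \<and> nfaces ?V d \<iota> = F}" for I
  define Y where "Y = {\<iota> \<in> cmaps ?V d. nfaces ?V d \<iota> = F}"
  have p: "fst ` ?H \<subseteq> ?V" by (auto simp: darts_def)
  have fin_p: "finite {\<iota>. pairing ?H \<iota>}" using fin by (intro finite_pairings finite_darts) simp
  have finX: "finite (X I)" for I by (rule finite_subset[OF _ fin_p]) (auto simp: X_def)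
  have finY: "finite Y" by (rule finite_subset[OF _ fin_p]) (auto simp: Y_def cmaps_def)
  have eq: "{\<iota>. pairing ?H \<iota> \<and> vconn V ?H (id(n := v) \<circ> fst) \<iota> \<and> nfaces ?V d \<iota> = F}
      = Y \<union> (\<Union>I\<in>Pow (V - {v}). X I)"
  proof (rule set_eqI)
    fix \<iota>
    show "\<iota> \<in> {\<iota>. pairing ?H \<iota> \<and> vconn V ?H (id(n := v) \<circ> fst) \<iota> \<and> nfaces ?V d \<iota> = F} \<longleftrightarrow>
      \<iota> \<in> Y \<union> (\<Union>I\<in>Pow (V - {v}). X I)"
    proof (cases "pairing ?H \<iota>")
      case True
      show ?thesis unfolding mem_Collect_eq conn_glue_cases[OF v True p]
        using True unfolding X_def Y_def cmaps_def by blast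
    next
      case False
      then show ?thesis by (simp add: X_def Y_def cmaps_def)
    qed
  qed
  have disjX: "X I \<inter> X J = {}" if "I \<in> Pow (V - {v})" "J \<in> Pow (V - {v})" "I \<noteq> J" for I J
  proof (rule ccontr)
    assume "X I \<inter> X J \<noteq> {}"
    then obtain \<iota> where i: "\<iota> \<in> X I" "\<iota> \<in> X J" by blast
    have "insert v I = insert v J"
      by (rule conn_closed_unique[of _ ?H fst \<iota>]) (use i in \<open>auto simp: X_def\<close>)
    then show False using that by auto
  qed
  have disjY: "Y \<inter> X I = {}" if I: "I \<in> Pow (V - {v})" for I
  proof (rule ccontr)
    assume "Y \<inter> X I \<noteq> {}"
    then obtain \<iota> where "vconn ?V ?H fst \<iota>" "closed_under ?H fst \<iota> (insert v I)"
      by (auto simp: X_def Y_def cmaps_def)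
    then have "insert v I = ?V" using I v by (intro vconnD) auto
    then show False using I v by auto
  qed
  have cX: "card (X I) = num_split_maps (insert v I) (insert n (V - {v} - I)) d F" if I: "I \<in> Pow (V - {v})" for I
  proof -
    have U: "insert v I \<union> insert n (V - {v} - I) = ?V" using I v by auto
    have "finite I" using I fin finite_subset[of I V] by auto
    moreover have "insert v I \<inter> insert n (V - {v} - I) = {}" using I v by auto
    ultimately show ?thesis
      using card_disconnected[of "insert v I" "insert n (V - {v} - I)" d F] fin
      unfolding U X_def by simp
  qed
  have "card (Y \<union> (\<Union>I\<in>Pow (V - {v}). X I)) = card Y + card (\<Union>I\<in>Pow (V - {v}). X I)"
    using fin finX finY disjY by (intro card_Un_disjoint) auto
  also have "card (\<Union>I\<in>Pow (V - {v}). X I) = (\<Sum>I\<in>Pow (V - {v}). card (X I))"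
    using fin finX disjX by (intro card_UN_disjoint) auto
  also have "\<dots> = (\<Sum>I\<in>Pow (V - {v}). num_split_maps (insert v I) (insert n (V - {v} - I)) d F)"
    by (rule sum.cong[OF refl cX])
  finally show ?thesis unfolding eq by (simp add: Y_def num_maps_def)
qed

lemma finite_splittings: "finite {(a, b). a + b + 2 = (m::nat)}"
  by (rule finite_subset[of _ "{..m} \<times> {..m}"]) auto

text \<open>The maps are sorted by the partner of the root dart \<open>(v, 0)\<close>. Degree 0 is
  allowed at the other vertices: there the factor \<open>d j\<close> vanishes, and with it any
  effect of the truncated subtraction.\<close>

lemma num_maps_recursion:
  assumes fin: "finite V" and v: "v \<in> V" "0 < d v" and n: "n \<notin> V"
  shows "num_maps V d F = (\<Sum>j\<in>V - {v}. d j * num_maps (V - {j}) (d(v := d v + d j - 2)) F)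
    + (\<Sum>(a, b)\<in>{(a, b). a + b + 2 = d v}. num_maps (insert n V) (d(v := a, n := b)) F
        + (\<Sum>I\<in>Pow (V - {v}). num_split_maps (insert v I) (insert n (V - {v} - I)) (d(v := a, n := b)) F))"
proof -
  define P where "P h = {\<iota> \<in> cmaps V d. nfaces V d \<iota> = F \<and> \<iota> (v, 0) = h}" for h
  let ?S = "SIGMA j:V - {v}. {..<d j}" and ?T = "{(a, b). a + b + 2 = d v}"
  let ?L = "(\<lambda>(a, b). (v, Suc a)) ` ?T"
  have hv: "(v, 0) \<in> darts V d" using v by (simp add: mem_darts)
  have finP: "finite (P h)" for h by (rule finite_subset[OF _ finite_cmaps[OF fin, of d]]) (auto simp: P_def)
  \<comment> \<open>A partner at \<open>v\<close> itself has index \<open>Suc a\<close>, with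
    \<open>a\<close> darts before it and \<open>b = d v - a - 2\<close> after it.\<close>
  have ST: "darts V d - {(v, 0)} = ?S \<union> ?L"
  proof (intro equalityI subsetI)
    fix h assume h: "h \<in> darts V d - {(v, 0)}"
    obtain u t where ut: "h = (u, t)" by (cases h)
    show "h \<in> ?S \<union> ?L"
    proof (cases "u = v")
      case True
      then have "0 < t" "t < d v" using h by (auto simp: ut mem_darts)
      then have "(t - 1, d v - t - 1) \<in> ?T" "h = (\<lambda>(a, b). (v, Suc a)) (t - 1, d v - t - 1)"
        using True by (auto simp: ut)
      then show ?thesis by blast
    next
      case False
      then show ?thesis using h by (auto simp: ut mem_darts)
    qed
  next
    fix h assume "h \<in> ?S \<union> ?L"
    then show "h \<in> darts V d - {(v, 0)}" using v by (auto simp: mem_darts)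
  qed
  have "{\<iota> \<in> cmaps V d. nfaces V d \<iota> = F} = (\<Union>h\<in>darts V d - {(v, 0)}. P h)"
    using hv by (auto simp: P_def cmaps_def pairing_def simp del: split_paired_All)
  then have "num_maps V d F = card (\<Union>h\<in>darts V d - {(v, 0)}. P h)" by (simp add: num_maps_def)
  also have "\<dots> = (\<Sum>h\<in>darts V d - {(v, 0)}. card (P h))"
    using finite_darts[OF fin] finP by (intro card_UN_disjoint) (auto simp: P_def)
  also have "\<dots> = (\<Sum>h\<in>?S. card (P h)) + (\<Sum>h\<in>?L. card (P h))"
    unfolding ST using fin finite_splittings by (intro sum.union_disjoint) auto
  also have "(\<Sum>h\<in>?S. card (P h)) = (\<Sum>j\<in>V - {v}. \<Sum>k<d j. card (P (j, k)))"
    using fin by (subst sum.Sigma) (auto intro!: sum.cong)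
  also have "\<dots> = (\<Sum>j\<in>V - {v}. d j * num_maps (V - {j}) (d(v := d v + d j - 2)) F)"
  proof (rule sum.cong[OF refl])
    fix j assume j: "j \<in> V - {v}"
    have "card (P (j, k)) = num_maps (V - {j}) (d(v := d v + d j - 2)) F" if "k < d j" for k
      unfolding P_def num_maps_def by (rule card_cmaps_merge) (use fin v j that in auto)
    then show "(\<Sum>k<d j. card (P (j, k))) = d j * num_maps (V - {j}) (d(v := d v + d j - 2)) F" by simp
  qed
  also have "(\<Sum>h\<in>?L. card (P h)) = (\<Sum>(a, b)\<in>?T. card (P (v, Suc a)))"
    by (subst sum.reindex) (auto simp: inj_on_def intro!: sum.cong)
  also have "\<dots> = (\<Sum>(a, b)\<in>?T. num_maps (insert n V) (d(v := a, n := b)) F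
        + (\<Sum>I\<in>Pow (V - {v}). num_split_maps (insert v I) (insert n (V - {v} - I)) (d(v := a, n := b)) F))"
  proof (rule sum.cong[OF refl], clarify)
    fix a b assume ab: "a + b + 2 = d v"
    show "card (P (v, Suc a)) = num_maps (insert n V) (d(v := a, n := b)) F
        + (\<Sum>I\<in>Pow (V - {v}). num_split_maps (insert v I) (insert n (V - {v} - I)) (d(v := a, n := b)) F)"
      unfolding P_def card_cmaps_split[of V v n a b d, OF fin v(1) n ab]
      by (rule card_glued[OF fin v(1) n])
  qed
  finally show ?thesis .
qed

subsection \<open>The Euler characteristic\<close>

text \<open>Euler's relation multiplied by 2, since \<open>sum d V\<close> is twice the number of
  edges. It is a relation between numbers, so it can be stated for an \<open>F\<close> before any
  map is known to have it.\<close>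

definition has_genus :: "int \<Rightarrow> 'v set \<Rightarrow> ('v \<Rightarrow> nat) \<Rightarrow> nat \<Rightarrow> bool" where
  "has_genus g V d F \<longleftrightarrow> 2 * int (card V) - int (sum d V) + 2 * int F = 4 - 4 * g"

lemma sum_merge:
  fixes d :: "'v \<Rightarrow> nat"
  assumes "finite V" "v \<in> V" "j \<in> V" "v \<noteq> j" "0 < d v" "0 < d j"
  shows "sum (d(v := d v + d j - 2)) (V - {j}) + 2 = sum d V"
proof -
  define U where "U = V - {v, j}"
  have U: "V = insert v (insert j U)" "V - {j} = insert v U" "v \<notin> U" "j \<notin> U" "finite U"
    using assms by (auto simp: U_def)
  have "sum (d(v := d v + d j - 2)) U = sum d U" by (rule sum.cong) (use U in auto)
  then have "sum (d(v := d v + d j - 2)) (V - {j}) = d v + d j - 2 + sum d U"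
    unfolding U(2) using U by (simp del: fun_upd_apply add: fun_upd_same)
  moreover have "sum d V = d v + d j + sum d U" unfolding U(1) using U assms by simp
  ultimately show ?thesis using assms by linarith
qed

text \<open>Contraction removes one vertex and one edge. Both degrees are positive, so the
  subtraction of 2 is exact.\<close>

lemma has_genus_merge:
  assumes "finite V" "v \<in> V" "j \<in> V" "v \<noteq> j" "0 < d v" "0 < d j"
  shows "has_genus g (V - {j}) (d(v := d v + d j - 2)) F \<longleftrightarrow> has_genus g V d F"
proof -
  have "card (V - {j}) + 1 = card V" using card_Suc_Diff1[of V j] assms by simp
  then show ?thesis using sum_merge[of V v j d] assms unfolding has_genus_def by linarith
qed

lemma sum_split:
  fixes d :: "'v \<Rightarrow> nat"
  assumes "finite V" "v \<in> V" "n \<notin> V" "a + b + 2 = d v"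
  shows "sum (d(v := a, n := b)) (insert n V) + 2 = sum d V"
proof -
  define U where "U = V - {v}"
  have U: "V = insert v U" "v \<notin> U" "n \<notin> U" "finite U" "v \<noteq> n" using assms by (auto simp: U_def)
  have "sum (d(v := a, n := b)) U = sum d U" by (rule sum.cong) (use U in auto)
  then have "sum (d(v := a, n := b)) (insert n V) = b + (a + sum d U)"
    unfolding U(1) using U by (simp del: fun_upd_apply add: fun_upd_same fun_upd_other)
  moreover have "sum d V = d v + sum d U" unfolding U(1) using U by simp
  ultimately show ?thesis using assms by linarith
qed

text \<open>One vertex more and one edge fewer raise the Euler characteristic by 2.\<close>

lemma has_genus_split:
  assumes "finite V" "v \<in> V" "n \<notin> V" "a + b + 2 = d v"
  shows "has_genus (g - 1) (insert n V) (d(v := a, n := b)) F \<longleftrightarrow> has_genus g V d F"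
proof -
  have "card (insert n V) = card V + 1" using assms by simp
  moreover have "sum d V = sum (d(v := a, n := b)) (insert n V) + 2"
    by (rule sum_split[symmetric]) (use assms in auto)
  ultimately show ?thesis unfolding has_genus_def by (simp only: of_nat_add) auto
qed

text \<open>Euler characteristics add under disjoint union: \<open>2 - 2 g1\<close> and
  \<open>2 - 2 g2\<close> sum to \<open>2 - 2 (g1 + g2 - 1)\<close>. The shift by 1 matches the one
  caused by cutting a loop, which yields \<open>g1 + g2 = g\<close>.\<close>

lemma has_genus_Un:
  assumes "finite K" "finite L" "K \<inter> L = {}" "has_genus g1 K d a" "has_genus g2 L d b"
  shows "has_genus (g1 + g2 - 1) (K \<union> L) d (a + b)"
  using assms by (simp add: has_genus_def card_Un_disjoint sum.union_disjoint)

text \<open>The recursion serves as an existence statement: a given map makes the left side nonzero,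
  hence some summand on the right is nonzero and provides smaller maps, whose genera are natural
  numbers by induction.\<close>

lemma euler_genus:
  fixes V :: "nat set"
  assumes "finite V" "\<iota> \<in> cmaps V d"
  shows "\<exists>g::nat. has_genus (int g) V d (nfaces V d \<iota>)"
  using assms
proof (induction "sum d V" arbitrary: V d \<iota> rule: less_induct)
  case less
  note fin = less.prems(1)
  let ?F = "nfaces V d \<iota>"
  have IH: "\<exists>g::nat. has_genus (int g) W e G"
    if "sum e W < sum d V" "finite W" "num_maps W e G \<noteq> 0" for W :: "nat set" and e G
  proof -
    have "{\<iota> \<in> cmaps W e. nfaces W e \<iota> = G} \<noteq> {}"
      using that(3) unfolding num_maps_def by (metis card.empty)
    then obtain \<kappa> where "\<kappa> \<in> cmaps W e" "nfaces W e \<kappa> = G" by blast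
    then show ?thesis using less.hyps[OF that(1,2)] by blast
  qed
  have cn: "vconn V (darts V d) fst \<iota>" using less.prems by (simp add: cmaps_def)
  then obtain v where v: "v \<in> V" by (auto simp: vconn_def)
  show ?case
  proof (cases "d v = 0")
    case True
    \<comment> \<open>An isolated vertex is closed by itself, so connectedness leaves it as the only
      vertex: the sphere with one vertex, no edge and one face.\<close>
    then have "closed_under (darts V d) fst \<iota> {v}" by (auto simp: closed_under_def darts_def)
    then have V: "V = {v}" using vconnD[OF cn, of "{v}"] v by auto
    have "darts V d = {}" "{u \<in> V. d u = 0} = {v}" unfolding V using True by (auto simp: darts_def)
    then have "?F = 1" by (simp add: nfaces_def)
    then have "has_genus (int 0) V d ?F" using True by (simp add: has_genus_def V)
    then show ?thesis ..
  next
    case False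
    then have dv: "0 < d v" by simp
    obtain n where n: "n \<notin> V" using ex_new_if_finite[OF infinite_UNIV_nat fin] by blast
    have "{\<kappa> \<in> cmaps V d. nfaces V d \<kappa> = ?F} \<noteq> {}" using less.prems by blast
    then have "num_maps V d ?F \<noteq> 0"
      using finite_cmaps[OF fin, of d] unfolding num_maps_def by (simp add: card_eq_0_iff)
    then consider
      (A) "(\<Sum>j\<in>V - {v}. d j * num_maps (V - {j}) (d(v := d v + d j - 2)) ?F) \<noteq> 0"
    | (B) "(\<Sum>(a, b)\<in>{(a, b). a + b + 2 = d v}. num_maps (insert n V) (d(v := a, n := b)) ?F
        + (\<Sum>I\<in>Pow (V - {v}). num_split_maps (insert v I) (insert n (V - {v} - I)) (d(v := a, n := b)) ?F)) \<noteq> 0"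
      unfolding num_maps_recursion[of V v d n, OF fin v dv n] by linarith
    then show ?thesis
    proof cases
      case A
      then obtain j where j: "j \<in> V - {v}" "d j * num_maps (V - {j}) (d(v := d v + d j - 2)) ?F \<noteq> 0"
        by (rule sum.not_neutral_contains_not_neutral)
      then have j': "j \<in> V" "v \<noteq> j" "0 < d j" by auto
      have "sum (d(v := d v + d j - 2)) (V - {j}) < sum d V"
        using sum_merge[OF fin v j'(1,2) dv j'(3)] by linarith
      then show ?thesis
        using IH[of "d(v := d v + d j - 2)" "V - {j}" ?F] j(2) fin
        by (simp add: has_genus_merge[OF fin v j'(1,2) dv j'(3)] del: fun_upd_apply)
    next
      case B
      then obtain ab where ab: "ab \<in> {(a, b). a + b + 2 = d v}"
        "(case ab of (a, b) \<Rightarrow> num_maps (insert n V) (d(v := a, n := b)) ?F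
        + (\<Sum>I\<in>Pow (V - {v}). num_split_maps (insert v I) (insert n (V - {v} - I)) (d(v := a, n := b)) ?F)) \<noteq> 0"
        by (rule sum.not_neutral_contains_not_neutral)
      obtain a b where [simp]: "ab = (a, b)" by (cases ab)
      let ?d = "d(v := a, n := b)"
      have e: "a + b + 2 = d v" using ab by simp
      note s = sum_split[of V v n a b d, OF fin v n e]
      consider (C) "num_maps (insert n V) ?d ?F \<noteq> 0"
        | (D) "(\<Sum>I\<in>Pow (V - {v}). num_split_maps (insert v I) (insert n (V - {v} - I)) ?d ?F) \<noteq> 0"
        using ab(2) by auto
      then show ?thesis
      proof cases
        case C
        then obtain g :: nat where "has_genus (int g) (insert n V) ?d ?F"
          using IH[of ?d "insert n V"] s fin by auto
        then have "has_genus (int (Suc g)) V d ?F"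
          using has_genus_split[of V v n a b d "int (Suc g)" ?F, OF fin v n e] by simp
        then show ?thesis ..
      next
        case D
        then obtain I where I: "I \<in> Pow (V - {v})" "num_split_maps (insert v I) (insert n (V - {v} - I)) ?d ?F \<noteq> 0"
          by (rule sum.not_neutral_contains_not_neutral)
        let ?K = "insert v I" and ?L = "insert n (V - {v} - I)"
        have fK: "finite ?K" "finite ?L" using fin I finite_subset[of I V] by auto
        have U: "insert n V = ?K \<union> ?L" "?K \<inter> ?L = {}" using I v n by auto
        have sKL: "sum ?d (insert n V) = sum ?d ?K + sum ?d ?L"
          unfolding U(1) by (rule sum.union_disjoint[OF fK U(2)])
        obtain x y where x: "x \<in> cmaps ?K ?d" and y: "y \<in> cmaps ?L ?d"
          and F: "nfaces ?K ?d x + nfaces ?L ?d y = ?F"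
        proof -
          have "{(x, y) \<in> cmaps ?K ?d \<times> cmaps ?L ?d. nfaces ?K ?d x + nfaces ?L ?d y = ?F} \<noteq> {}"
            using I(2) unfolding num_split_maps_def by (metis card.empty)
          then show ?thesis using that by blast
        qed
        obtain g1 :: nat where g1: "has_genus (int g1) ?K ?d (nfaces ?K ?d x)"
          using less.hyps[OF _ fK(1) x] s sKL by auto
        obtain g2 :: nat where g2: "has_genus (int g2) ?L ?d (nfaces ?L ?d y)"
          using less.hyps[OF _ fK(2) y] s sKL by auto
        have "has_genus (int (g1 + g2) - 1) (insert n V) ?d ?F"
          using has_genus_Un[OF fK U(2) g1 g2] by (simp only: U(1) F of_nat_add)
        then have "has_genus (int (g1 + g2)) V d ?F"
          using has_genus_split[of V v n a b d, OF fin v n e] by blast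
        then show ?thesis ..
      qed
    qed
  qed
qed

subsection \<open>Counting by genus\<close>

definition gcount ::"int \<Rightarrow> 'v set \<Rightarrow> ('v \<Rightarrow> nat) \<Rightarrow> nat" where
  "gcount g V d = card {\<iota> \<in> cmaps V d. has_genus g V d (nfaces V d \<iota>)}"

lemma gcount_eq_num_maps: "has_genus g V d F \<Longrightarrow> gcount g V d = num_maps V d F"
  unfolding gcount_def num_maps_def has_genus_def by (rule arg_cong[where f = card]) auto

lemma gcount_eq_0: "\<forall>F. \<not> has_genus g V d F \<Longrightarrow> gcount g V d = 0"
  by (simp add: gcount_def)

lemma gcount_neg:
  fixes V :: "nat set"
  assumes "finite V" "g < 0"
  shows "gcount g V d = 0"
proof -
  have "{\<iota> \<in> cmaps V d. has_genus g V d (nfaces V d \<iota>)} = {}"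
    using euler_genus[OF assms(1)] assms(2) by (fastforce simp: has_genus_def)
  then show ?thesis unfolding gcount_def by (metis card.empty)
qed

text \<open>\<open>euler_genus\<close> ensures that no pair escapes the sum: both components have
  natural genera, and the total face number forces these to add up to \<open>g\<close>. Hence the
  pairs are sorted by \<open>g1\<close> alone.\<close>

lemma gcount_product:
  fixes K L :: "nat set"
  assumes fin: "finite K" "finite L" and disj: "K \<inter> L = {}"
    and F: "has_genus (int g - 1) (K \<union> L) d F"
  shows "(\<Sum>g1\<in>{0..g}. gcount (int g1) K d * gcount (int (g - g1)) L d) = num_split_maps K L d F"
proof -
  define P where "P h = {x \<in> cmaps K d. has_genus (int h) K d (nfaces K d x)}" for h
  define Q where "Q h = {x \<in> cmaps L d. has_genus (int h) L d (nfaces L d x)}" for h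
  have fPQ: "finite (P h)" "finite (Q h)" for h
    using finite_cmaps[OF fin(1), of d] finite_cmaps[OF fin(2), of d] by (auto simp: P_def Q_def)
  have add: "has_genus (int g - 1) (K \<union> L) d F' \<longleftrightarrow> F' = F" for F'
    using F by (auto simp: has_genus_def)
  have gen: "has_genus (int g - 1) (K \<union> L) d (a + b) \<longleftrightarrow> g1 + g2 = g"
    if "has_genus (int g1) K d a" "has_genus (int g2) L d b" for a b g1 g2
    using that fin disj by (auto simp: has_genus_def card_Un_disjoint sum.union_disjoint)
  have "{(x, y) \<in> cmaps K d \<times> cmaps L d. nfaces K d x + nfaces L d y = F} = (\<Union>g1\<in>{0..g}. P g1 \<times> Q (g - g1))"
  proof (intro equalityI subsetI)
    fix xy assume "xy \<in> {(x, y) \<in> cmaps K d \<times> cmaps L d. nfaces K d x + nfaces L d y = F}"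
    then obtain x y where xy: "xy = (x, y)" "x \<in> cmaps K d" "y \<in> cmaps L d" "nfaces K d x + nfaces L d y = F" by blast
    obtain g1 :: nat where g1: "has_genus (int g1) K d (nfaces K d x)" using euler_genus[OF fin(1) xy(2)] ..
    obtain g2 :: nat where g2: "has_genus (int g2) L d (nfaces L d y)" using euler_genus[OF fin(2) xy(3)] ..
    have "g1 + g2 = g" using gen[OF g1 g2] add xy(4) by simp
    then have "g1 \<in> {0..g}" "g2 = g - g1" by auto
    then show "xy \<in> (\<Union>g1\<in>{0..g}. P g1 \<times> Q (g - g1))" using xy g1 g2 by (auto simp: P_def Q_def)
  next
    fix xy assume "xy \<in> (\<Union>g1\<in>{0..g}. P g1 \<times> Q (g - g1))"
    then obtain g1 x y where g1: "g1 \<le> g" and xy: "xy = (x, y)" "x \<in> P g1" "y \<in> Q (g - g1)" by auto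
    have "nfaces K d x + nfaces L d y = F"
      using gen[of g1 "nfaces K d x" "g - g1" "nfaces L d y"] add xy g1 by (simp add: P_def Q_def)
    then show "xy \<in> {(x, y) \<in> cmaps K d \<times> cmaps L d. nfaces K d x + nfaces L d y = F}"
      using xy by (simp add: P_def Q_def)
  qed
  then have "num_split_maps K L d F = card (\<Union>g1\<in>{0..g}. P g1 \<times> Q (g - g1))" by (simp add: num_split_maps_def)
  also have "\<dots> = (\<Sum>g1\<in>{0..g}. card (P g1 \<times> Q (g - g1)))"
    using fPQ by (intro card_UN_disjoint) (auto simp: P_def has_genus_def)
  also have "\<dots> = (\<Sum>g1\<in>{0..g}. gcount (int g1) K d * gcount (int (g - g1)) L d)"
    by (simp add: card_cartesian_product gcount_def P_def Q_def)
  finally show ?thesis by simp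
qed

text \<open>Two nonzero factors would supply face numbers \<open>a\<close> and \<open>b\<close>
  whose sum solves Euler's relation for the union.\<close>

lemma gcount_product_0:
  assumes fin: "finite K" "finite L" and disj: "K \<inter> L = {}"
    and F: "\<forall>F. \<not> has_genus (int g - 1) (K \<union> L) d F" and g1: "g1 \<le> g"
  shows "gcount (int g1) K d * gcount (int (g - g1)) L d = 0"
proof (rule ccontr)
  assume "\<not> ?thesis"
  then obtain a b where "has_genus (int g1) K d a" "has_genus (int (g - g1)) L d b"
    using gcount_eq_0[of "int g1" K d] gcount_eq_0[of "int (g - g1)" L d] by auto
  from has_genus_Un[OF fin disj this] have "has_genus (int g - 1) (K \<union> L) d (a + b)"
    using g1 by (simp add: of_nat_diff)
  then show False using F by blast
qed

text \<open>For fixed degrees, genus and face number determine each other, so the recursion by faces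
  carries over when some \<open>F\<close> fits \<open>g\<close>. If none fits, because the degree
  sum is odd or the genus too large, the same holds for every smaller problem and both sides
  vanish.\<close>

lemma gcount_recursion:
  fixes V :: "nat set"
  assumes fin: "finite V" and v: "v \<in> V" and d: "\<And>u. u \<in> V \<Longrightarrow> 0 < d u" and n: "n \<notin> V"
  shows "gcount (int g) V d = (\<Sum>j\<in>V - {v}. d j * gcount (int g) (V - {j}) (d(v := d v + d j - 2)))
    + (\<Sum>(a, b)\<in>{(a, b). a + b + 2 = d v}. gcount (int g - 1) (insert n V) (d(v := a, n := b))
        + (\<Sum>g1\<in>{0..g}. \<Sum>I\<in>Pow (V - {v}). gcount (int g1) (insert v I) (d(v := a, n := b))
             * gcount (int (g - g1)) (insert n (V - {v} - I)) (d(v := a, n := b))))"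
proof -
  have KL: "finite (insert v I)" "finite (insert n (V - {v} - I))" "insert v I \<inter> insert n (V - {v} - I) = {}"
    "insert v I \<union> insert n (V - {v} - I) = insert n V" if "I \<in> Pow (V - {v})" for I
    using that fin v n finite_subset[of I V] by auto
  show ?thesis
  proof (cases "\<exists>F. has_genus (int g) V d F")
    case True
    then obtain F where F: "has_genus (int g) V d F" ..
    have "gcount (int g) (V - {j}) (d(v := d v + d j - 2)) = num_maps (V - {j}) (d(v := d v + d j - 2)) F"
      if "j \<in> V - {v}" for j
      using that F has_genus_merge[of V v j d] d fin v by (intro gcount_eq_num_maps) auto
    moreover have "gcount (int g - 1) (insert n V) (d(v := a, n := b)) = num_maps (insert n V) (d(v := a, n := b)) F"
      and "(\<Sum>g1\<in>{0..g}. \<Sum>I\<in>Pow (V - {v}). gcount (int g1) (insert v I) (d(v := a, n := b))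
             * gcount (int (g - g1)) (insert n (V - {v} - I)) (d(v := a, n := b)))
           = (\<Sum>I\<in>Pow (V - {v}). num_split_maps (insert v I) (insert n (V - {v} - I)) (d(v := a, n := b)) F)"
      if ab: "a + b + 2 = d v" for a b
    proof -
      have F': "has_genus (int g - 1) (insert n V) (d(v := a, n := b)) F"
        using has_genus_split[of V v n a b d, OF fin v n ab] F by simp
      then show "gcount (int g - 1) (insert n V) (d(v := a, n := b)) = num_maps (insert n V) (d(v := a, n := b)) F"
        by (rule gcount_eq_num_maps)
      show "(\<Sum>g1\<in>{0..g}. \<Sum>I\<in>Pow (V - {v}). gcount (int g1) (insert v I) (d(v := a, n := b))
             * gcount (int (g - g1)) (insert n (V - {v} - I)) (d(v := a, n := b)))
           = (\<Sum>I\<in>Pow (V - {v}). num_split_maps (insert v I) (insert n (V - {v} - I)) (d(v := a, n := b)) F)"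
        \<comment> \<open>With the partition fixed first, the inner sum over \<open>g1\<close>
          recombines the genera of the two components.\<close>
        by (subst sum.swap, rule sum.cong[OF refl], rule gcount_product) (use KL F' in simp_all)
    qed
    ultimately show ?thesis
      unfolding gcount_eq_num_maps[OF F] num_maps_recursion[of V v d n, OF fin v d[OF v] n]
      by (intro arg_cong2[where f = "(+)"] sum.cong) auto
  next
    case False
    then have no: "\<forall>F. \<not> has_genus (int g) V d F" by blast
    have A: "gcount (int g) (V - {j}) (d(v := d v + d j - 2)) = 0" if "j \<in> V - {v}" for j
      using that no has_genus_merge[of V v j d] d fin v by (intro gcount_eq_0) auto
    have B: "gcount (int g - 1) (insert n V) (d(v := a, n := b)) = 0"
      and C: "(\<Sum>g1\<in>{0..g}. \<Sum>I\<in>Pow (V - {v}). gcount (int g1) (insert v I) (d(v := a, n := b))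
             * gcount (int (g - g1)) (insert n (V - {v} - I)) (d(v := a, n := b))) = 0"
      if ab: "a + b + 2 = d v" for a b
    proof -
      have no': "\<forall>F. \<not> has_genus (int g - 1) (insert n V) (d(v := a, n := b)) F"
        using has_genus_split[of V v n a b d, OF fin v n ab] no by simp
      then show "gcount (int g - 1) (insert n V) (d(v := a, n := b)) = 0" by (rule gcount_eq_0)
      show "(\<Sum>g1\<in>{0..g}. \<Sum>I\<in>Pow (V - {v}). gcount (int g1) (insert v I) (d(v := a, n := b))
             * gcount (int (g - g1)) (insert n (V - {v} - I)) (d(v := a, n := b))) = 0"
        by (intro sum.neutral ballI gcount_product_0) (use KL no' in simp_all)
    qed
    have "(\<Sum>j\<in>V - {v}. d j * gcount (int g) (V - {j}) (d(v := d v + d j - 2))) = 0"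
      by (rule sum.neutral) (use A in simp)
    moreover have "(\<Sum>(a, b)\<in>{(a, b). a + b + 2 = d v}. gcount (int g - 1) (insert n V) (d(v := a, n := b))
        + (\<Sum>g1\<in>{0..g}. \<Sum>I\<in>Pow (V - {v}). gcount (int g1) (insert v I) (d(v := a, n := b))
             * gcount (int (g - g1)) (insert n (V - {v} - I)) (d(v := a, n := b)))) = 0"
    proof (rule sum.neutral, rule ballI)
      fix ab assume ab: "ab \<in> {(a, b). a + b + 2 = d v}"
      obtain a b where e: "ab = (a, b)" by (cases ab)
      have "a + b + 2 = d v" using ab e by simp
      then show "(case ab of (a, b) \<Rightarrow> gcount (int g - 1) (insert n V) (d(v := a, n := b))
        + (\<Sum>g1\<in>{0..g}. \<Sum>I\<in>Pow (V - {v}). gcount (int g1) (insert v I) (d(v := a, n := b))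
             * gcount (int (g - g1)) (insert n (V - {v} - I)) (d(v := a, n := b)))) = 0"
        unfolding e prod.case using B[of a b] C[of a b] by simp
    qed
    ultimately show ?thesis unfolding gcount_eq_0[OF no] by simp
  qed
qed

subsection \<open>Generalized Catalan numbers\<close>

text \<open>A bijection of vertices that preserves degrees acts on darts with indices kept, so it
  commutes with rotation and preserves faces and genus.\<close>

lemma gcount_relabel:
  assumes r: "bij_betw r V W" and d: "\<And>v. v \<in> V \<Longrightarrow> e (r v) = d v"
  shows "gcount g V d = gcount g W e"
proof -
  define f where "f = (\<lambda>h. (r (fst h), snd h :: nat))"
  let ?T = "transport (darts V d) (darts W e) f"
  have W: "W = r ` V" and inj: "inj_on r V" using r by (auto simp: bij_betw_def)
  have f: "bij_betw f (darts V d) (darts W e)"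
    unfolding bij_betw_def
  proof
    show "inj_on f (darts V d)" using inj by (auto simp: f_def inj_on_def darts_def)
    show "f ` darts V d = darts W e"
    proof (intro equalityI subsetI)
      fix h assume "h \<in> darts W e"
      then obtain v k where "h = (r v, k)" "v \<in> V" "k < d v" using d by (auto simp: darts_def W)
      then have "h = f (v, k)" "(v, k) \<in> darts V d" by (auto simp: f_def mem_darts)
      then show "h \<in> f ` darts V d" by blast
    qed (auto simp: f_def darts_def W d)
  qed
  have rot: "f (rot d h) = rot e (f h)" if "h \<in> darts V d" for h
    using that d by (auto simp: f_def rot_def darts_def)
  have "card V = card W" by (rule bij_betw_same_card[OF r])
  moreover have "sum d V = sum e W" using sum.reindex_bij_betw[OF r, of e] d by simp
  ultimately have genus: "has_genus g V d F \<longleftrightarrow> has_genus g W e F" for F by (simp add: has_genus_def)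
  have z: "card {v \<in> V. d v = 0} = card {w \<in> W. e w = 0}"
    by (rule card_restricted_bij[OF r]) (simp add: d)
  have "card {\<iota> \<in> {\<iota>. pairing (darts V d) \<iota>}. vconn V (darts V d) fst \<iota> \<and> has_genus g V d (nfaces V d \<iota>)}
     = card {\<iota> \<in> {\<iota>. pairing (darts W e) \<iota>}. vconn W (darts W e) fst \<iota> \<and> has_genus g W e (nfaces W e \<iota>)}"
  proof (rule card_restricted_bij[OF bij_transport[OF f]])
    fix \<iota> assume "\<iota> \<in> {\<iota>. pairing (darts V d) \<iota>}"
    then have \<iota>: "pairing (darts V d) \<iota>" by simp
    have "vconn W (darts W e) fst (?T \<iota>) \<longleftrightarrow> vconn V (darts V d) fst \<iota>"
      by (rule conn_transport[OF f \<iota> _ r]) (auto simp: f_def darts_def)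
    moreover have "card (orb (rot e \<circ> ?T \<iota>) ` darts W e) = card (orb (rot d \<circ> \<iota>) ` darts V d)"
      by (rule card_orbs_transport[OF f \<iota>]) (use rot rot_into[of d V] in auto)
    ultimately show "(vconn V (darts V d) fst \<iota> \<and> has_genus g V d (nfaces V d \<iota>)) \<longleftrightarrow>
      (vconn W (darts W e) fst (?T \<iota>) \<and> has_genus g W e (nfaces W e (?T \<iota>)))"
      by (simp add: nfaces_def z genus)
  qed
  then show ?thesis by (simp add: gcount_def cmaps_def conj_assoc)
qed

section \<open>From lists of degrees to sets of vertices\<close>

lemma half_edges_eq_darts: "half_edges mu = darts {..<length mu} ((!) mu)"
  by (auto simp: half_edges_def darts_def)

lemma is_pairing_pairing: "is_pairing mu \<iota> \<longleftrightarrow> pairing (half_edges mu) \<iota>"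
  unfolding is_pairing_def pairing_def ..

lemma vrot_rot: "h \<in> half_edges mu \<Longrightarrow> vrot mu h = rot ((!) mu) h"
  by (auto simp: vrot_def rot_def half_edges_def)

lemma num_faces_orb:
  assumes "is_pairing mu \<iota>"
  shows "num_faces mu \<iota> = card (orb (rot ((!) mu) \<circ> \<iota>) ` half_edges mu)"
proof -
  have i: "\<iota> h \<in> half_edges mu" if "h \<in> half_edges mu" for h
    using assms that by (simp add: is_pairing_pairing pairing_def)
  have "{{((vrot mu \<circ> \<iota>) ^^ k) h | k. True} | h. h \<in> half_edges mu} = orb (vrot mu \<circ> \<iota>) ` half_edges mu"
    by (auto simp: orb_def)
  also have "\<dots> = orb (rot ((!) mu) \<circ> \<iota>) ` half_edges mu"
  proof (rule image_cong[OF refl])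
    fix h assume "h \<in> half_edges mu"
    then show "orb (vrot mu \<circ> \<iota>) h = orb (rot ((!) mu) \<circ> \<iota>) h"
    proof (rule orb_cong)
      fix z assume "z \<in> half_edges mu"
      then have "\<iota> z \<in> half_edges mu" by (rule i)
      then show "(vrot mu \<circ> \<iota>) z = (rot ((!) mu) \<circ> \<iota>) z" "(vrot mu \<circ> \<iota>) z \<in> half_edges mu"
        using rot_into[of "(!) mu" "{..<length mu}"] by (auto simp: vrot_rot simp flip: half_edges_eq_darts)
    qed
  qed
  finally show ?thesis by (simp add: num_faces_def)
qed

text \<open>With positive degrees, every vertex carries darts and the rotation is transitive on
  them. An orbit under rotation and pairing is then the full set of darts over a closed set of
  vertices.\<close>

lemma connected_map_conn:
  assumes \<iota>: "is_pairing mu \<iota>" and mu: "mu \<noteq> []" "0 \<notin> set mu"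
  shows "connected_map mu \<iota> \<longleftrightarrow> vconn {..<length mu} (half_edges mu) fst \<iota>"
proof -
  let ?V = "{..<length mu}" and ?H = "half_edges mu"
  let ?R = "{(x, vrot mu x) | x. x \<in> ?H} \<union> {(x, \<iota> x) | x. x \<in> ?H}"
  have pos: "0 < mu ! i" if "i < length mu" for i using mu that by (metis gr0I nth_mem)
  have root: "(i, 0) \<in> ?H" if "i < length mu" for i using pos[OF that] that by (simp add: half_edges_def)
  have i: "\<iota> h \<in> ?H" if "h \<in> ?H" for h using \<iota> that by (simp add: is_pairing_pairing pairing_def)
  have v: "vrot mu h \<in> ?H" if "h \<in> ?H" for h using that by (auto simp: vrot_def half_edges_def)
  show ?thesis
  proof
    assume c: "connected_map mu \<iota>"
    have "S = ?V" if S: "S \<subseteq> ?V" "S \<noteq> {}" "closed_under ?H fst \<iota> S" for S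
    proof -
      obtain u where u: "u \<in> S" using S by blast
      have "w \<in> S" if w: "w < length mu" for w
      proof -
        have "((u, 0), (w, 0)) \<in> ?R\<^sup>*"
          using c root[of u] root[OF w] u S(1) unfolding connected_map_def by blast
        then have "fst (w, 0::nat) \<in> S"
          by (induction rule: rtrancl_induct) (use u S(3) in \<open>auto simp: closed_under_def vrot_def\<close>)
        then show ?thesis by simp
      qed
      then show ?thesis using S by blast
    qed
    then show "vconn ?V ?H fst \<iota>" using mu unfolding vconn_def by auto
  next
    assume c: "vconn ?V ?H fst \<iota>"
    show "connected_map mu \<iota>" unfolding connected_map_def
    proof (intro ballI)
      fix h h' assume h: "h \<in> ?H" and h': "h' \<in> ?H"
      define T where "T = {x. (h, x) \<in> ?R\<^sup>*}"
      have TR: "y \<in> T" if "x \<in> T" "(x, y) \<in> ?R" for x y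
        using that unfolding T_def by (auto intro: rtrancl_into_rtrancl)
      have Tv: "vrot mu x \<in> T" if "x \<in> T" "x \<in> ?H" for x using TR[OF that(1), of "vrot mu x"] that(2) by blast
      have Ti: "\<iota> x \<in> T" if "x \<in> T" "x \<in> ?H" for x using TR[OF that(1), of "\<iota> x"] that(2) by blast
      have TH: "x \<in> ?H" if "x \<in> T" for x
      proof -
        have "(h, x) \<in> ?R\<^sup>*" using that by (simp add: T_def)
        then show ?thesis
          by (induction rule: rtrancl_induct) (use h i v in auto)
      qed
      \<comment> \<open>Repeated rotation reaches all later darts of the vertex; wrapping around at
        the last one then gives the earlier ones, so \<open>T\<close> contains all darts of each
        vertex that it meets.\<close>
      have up: "(v, k + m) \<in> T" if "(v, k) \<in> T" "k + m < mu ! v" for v k m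
        using that(2)
      proof (induction m)
        case (Suc m)
        then have "(v, k + m) \<in> T" by simp
        from Tv[OF this TH[OF this]] show ?case using Suc.prems by (simp add: vrot_def)
      qed (use that in simp)
      have fib: "(v, k') \<in> T" if vk: "(v, k) \<in> T" and k': "k' < mu ! v" for v k k'
      proof -
        have k: "k < mu ! v" using TH[OF vk] by (simp add: half_edges_def)
        then have "(v, mu ! v - 1) \<in> T" using up[OF vk, of "mu ! v - 1 - k"] by simp
        from Tv[OF this TH[OF this]] have "(v, 0) \<in> T" using k by (simp add: vrot_def)
        then show ?thesis using up[of v 0 k'] k' by simp
      qed
      have cl: "closed_under ?H fst \<iota> (fst ` T)" unfolding closed_under_def
      proof (intro ballI impI)
        fix x assume x: "x \<in> ?H" "fst x \<in> fst ` T"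
        then have "x \<in> T" using fib by (auto simp: half_edges_def)
        then show "fst (\<iota> x) \<in> fst ` T" using Ti x(1) by blast
      qed
      have "h \<in> T" by (simp add: T_def)
      moreover have "fst ` T \<subseteq> ?V" using TH by (auto simp: half_edges_def)
      ultimately have "fst ` T = ?V" by (intro vconnD[OF c _ _ cl]) auto
      then have "fst h' \<in> fst ` T" using h' by (auto simp: half_edges_def)
      then have "h' \<in> T" using fib h' by (auto simp: half_edges_def)
      then show "(h, h') \<in> ?R\<^sup>*" by (simp add: T_def)
    qed
  qed
qed

text \<open>All conventions come out as values of one count: a single isolated vertex has one empty
  pairing and one face, an isolated vertex among several destroys connectedness, the empty vertex
  set is not connected, and negative genus is excluded by \<open>euler_genus\<close>.\<close>

lemma Cat_eq_gcount_nth: "Cat g mu = gcount g {..<length mu} ((!) mu)"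
proof -
  let ?V = "{..<length mu}" and ?d = "(!) mu"
  consider "g < 0" | "\<not> g < 0" "mu = [0]" | "\<not> g < 0" "mu \<noteq> [0]" "mu = []"
    | "\<not> g < 0" "mu \<noteq> [0]" "mu \<noteq> []" "0 \<in> set mu" | "\<not> g < 0" "mu \<noteq> []" "0 \<notin> set mu" by blast
  then show ?thesis
  proof cases
    case 1
    then show ?thesis by (simp add: Cat_def gcount_neg)
  next
    case 2
    have V: "{..<Suc 0} = {0::nat}" by auto
    have H: "darts {0} ((!) [0]) = {}" by (auto simp: darts_def)
    have "pairing {} \<iota> \<longleftrightarrow> \<iota> = id" for \<iota> :: "nat \<times> nat \<Rightarrow> _"
      unfolding pairing_def fun_eq_iff by simp
    moreover have "vconn {0} {} fst \<iota>" for \<iota> :: "nat \<times> nat \<Rightarrow> _" by (auto simp: vconn_def)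
    ultimately have c: "cmaps {0} ((!) [0]) = {id}" by (simp add: cmaps_def H)
    have "{v \<in> {0}. [0] ! v = (0::nat)} = {0}" by auto
    then have "nfaces {0} ((!) [0]) id = 1" by (simp add: nfaces_def H)
    then have "{\<iota> \<in> cmaps {0} ((!) [0]). has_genus g {0} ((!) [0]) (nfaces {0} ((!) [0]) \<iota>)} = (if g = 0 then {id} else {})"
      by (auto simp: c has_genus_def)
    then show ?thesis using 2 by (simp add: Cat_def gcount_def V)
  next
    case 3
    then show ?thesis by (simp add: Cat_def gcount_def cmaps_def vconn_def)
  next
    case 4
    then obtain i where i: "i < length mu" "mu ! i = 0" by (metis in_set_conv_nth)
    have l: "length mu \<noteq> 1" using 4 by (cases mu) auto
    have "\<not> vconn ?V (darts ?V ?d) fst \<iota>" for \<iota>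
    proof
      assume c: "vconn ?V (darts ?V ?d) fst \<iota>"
      have "closed_under (darts ?V ?d) fst \<iota> {i}" using i by (auto simp: closed_under_def darts_def)
      then have "{i} = ?V" using i by (intro vconnD[OF c]) auto
      then have "card ?V = 1" by (metis card_1_singleton_iff One_nat_def)
      then show False using l by simp
    qed
    then show ?thesis using 4 by (simp add: Cat_def gcount_def cmaps_def)
  next
    case 5
    have z: "{v \<in> ?V. ?d v = 0} = {}" using 5 by (auto simp: in_set_conv_nth)
    have s: "sum ?d ?V = sum_list mu" by (simp add: sum_list_sum_nth atLeast0LessThan)
    have "arrowed_graphs g mu = {\<iota> \<in> cmaps ?V ?d. has_genus g ?V ?d (nfaces ?V ?d \<iota>)}"
    proof (rule set_eqI)
      fix \<iota>
      show "\<iota> \<in> arrowed_graphs g mu \<longleftrightarrow> \<iota> \<in> {\<iota> \<in> cmaps ?V ?d. has_genus g ?V ?d (nfaces ?V ?d \<iota>)}"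
      proof (cases "is_pairing mu \<iota>")
        case True
        have "nfaces ?V ?d \<iota> = num_faces mu \<iota>"
          unfolding nfaces_def z num_faces_orb[OF True] half_edges_eq_darts by simp
        moreover have "\<iota> \<in> cmaps ?V ?d \<longleftrightarrow> connected_map mu \<iota>"
          using True unfolding cmaps_def connected_map_conn[OF True 5(2,3)]
          by (simp add: is_pairing_pairing half_edges_eq_darts)
        ultimately show ?thesis using True by (simp add: arrowed_graphs_def has_genus_def s)
      next
        case False
        then show ?thesis by (simp add: arrowed_graphs_def cmaps_def is_pairing_pairing half_edges_eq_darts)
      qed
    qed
    then show ?thesis using 5 by (auto simp: Cat_def gcount_def)
  qed
qed

text \<open>Any enumeration \<open>xs\<close> of the vertices may be used, so the order in which
  degrees appear in a list is immaterial.\<close>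

lemma Cat_map:
  assumes "distinct xs"
  shows "Cat g (map d xs) = gcount g (set xs) d"
proof -
  have "bij_betw ((!) xs) {..<length xs} (set xs)" by (rule bij_betw_nth[OF assms refl refl])
  then show ?thesis unfolding Cat_eq_gcount_nth
    by (simp only: length_map) (rule gcount_relabel, auto)
qed

theorem theorem3p1:
  fixes g :: nat and mu :: "nat list"
  assumes "length mu \<ge> 1" and "\<forall>m \<in> set mu. m \<ge> 1"
  shows "Cat (int g) mu =
    (\<Sum>j \<in> {1..<length mu}. mu ! j *
        Cat (int g) ((mu ! 0 + mu ! j - 2) # sublist_idx mu ({1..<length mu} - {j})))
    + (\<Sum>(a, b) \<in> {(a, b). a + b + 2 = mu ! 0}.
        Cat (int g - 1) (a # b # sublist_idx mu {1..<length mu})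
        + (\<Sum>g1 \<in> {0..g}. \<Sum>I \<in> Pow {1..<length mu}.
             Cat (int g1) (a # sublist_idx mu I) *
             Cat (int (g - g1)) (b # sublist_idx mu ({1..<length mu} - I))))"
proof -
  \<comment> \<open>The root is vertex 0. The number \<open>?n\<close> is also the first index
    outside \<open>?V\<close> and serves as the fresh vertex created by cutting a loop.\<close>
  let ?n = "length mu" and ?d = "(!) mu"
  let ?V = "{..<?n}" and ?A = "{1..<?n}"
  have V: "?V = insert 0 ?A" "?V - {0} = ?A" using assms(1) by auto
  have idx: "sublist_idx mu I = map e (sorted_list_of_set I)" if "\<And>i. i \<in> I \<Longrightarrow> e i = mu ! i" "finite I" for I e
    using that by (simp add: sublist_idx_def)
  have c1: "Cat h (e v # sublist_idx mu I) = gcount h (insert v I) e"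
    if "\<And>i. i \<in> I \<Longrightarrow> e i = mu ! i" "finite I" "v \<notin> I" for h e v I
    using Cat_map[of "v # sorted_list_of_set I" h e] that by (simp add: idx[of I e])
  have A: "Cat (int g) ((mu ! 0 + mu ! j - 2) # sublist_idx mu (?A - {j}))
      = gcount (int g) (?V - {j}) (?d(0 := ?d 0 + ?d j - 2))" if "j \<in> ?V - {0}" for j
  proof -
    have "insert 0 (?A - {j}) = ?V - {j}" using that by auto
    then show ?thesis using c1[of "?A - {j}" "?d(0 := ?d 0 + ?d j - 2)" 0 "int g"] by simp
  qed
  \<comment> \<open>The fresh vertex has the largest index but the second place in the list; the
    enumeration \<open>0, ?n, 1, 2, ...\<close> accounts for this.\<close>
  have B: "Cat h (a # b # sublist_idx mu ?A) = gcount h (insert ?n ?V) (?d(0 := a, ?n := b))" for h a b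
  proof -
    have "insert 0 (insert ?n ?A) = insert ?n ?V" using V by auto
    moreover have "0 \<noteq> ?n" using assms(1) by auto
    ultimately show ?thesis
      using Cat_map[of "0 # ?n # sorted_list_of_set ?A" h "?d(0 := a, ?n := b)"]
        idx[of ?A "?d(0 := a, ?n := b)"] by simp
  qed
  have C: "Cat h (a # sublist_idx mu I) = gcount h (insert 0 I) (?d(0 := a, ?n := b))"
    and D: "Cat h (b # sublist_idx mu (?A - I)) = gcount h (insert ?n (?V - {0} - I)) (?d(0 := a, ?n := b))"
    if I: "I \<in> Pow (?V - {0})" for h a b I
  proof -
    have n0: "?n \<noteq> 0" using assms(1) by auto
    have I': "finite I" "0 \<notin> I" "?n \<notin> I" using I finite_subset[of I ?V] by auto
    have "(?d(0 := a, ?n := b)) i = mu ! i" if "i \<in> I" for i using I' that by auto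
    then show "Cat h (a # sublist_idx mu I) = gcount h (insert 0 I) (?d(0 := a, ?n := b))"
      using c1[of I "?d(0 := a, ?n := b)" 0 h] I' n0 by simp
    show "Cat h (b # sublist_idx mu (?A - I)) = gcount h (insert ?n (?V - {0} - I)) (?d(0 := a, ?n := b))"
      unfolding V(2) using c1[of "?A - I" "?d(0 := a, ?n := b)" ?n h] n0 by simp
  qed
  have pos: "0 < ?d u" if "u \<in> ?V" for u using assms(2) that by (metis lessThan_iff nth_mem less_eq_Suc_le One_nat_def)
  have "Cat (int g) mu = gcount (int g) ?V ?d" by (rule Cat_eq_gcount_nth)
  also have "\<dots> = (\<Sum>j\<in>?V - {0}. ?d j * gcount (int g) (?V - {j}) (?d(0 := ?d 0 + ?d j - 2)))
    + (\<Sum>(a, b)\<in>{(a, b). a + b + 2 = ?d 0}. gcount (int g - 1) (insert ?n ?V) (?d(0 := a, ?n := b))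
        + (\<Sum>g1\<in>{0..g}. \<Sum>I\<in>Pow (?V - {0}). gcount (int g1) (insert 0 I) (?d(0 := a, ?n := b))
             * gcount (int (g - g1)) (insert ?n (?V - {0} - I)) (?d(0 := a, ?n := b))))"
    by (rule gcount_recursion) (use pos V(1) in auto)
  also have "\<dots> = (\<Sum>j\<in>?V - {0}. mu ! j * Cat (int g) ((mu ! 0 + mu ! j - 2) # sublist_idx mu (?A - {j})))
    + (\<Sum>(a, b)\<in>{(a, b). a + b + 2 = mu ! 0}. Cat (int g - 1) (a # b # sublist_idx mu ?A)
        + (\<Sum>g1\<in>{0..g}. \<Sum>I\<in>Pow (?V - {0}). Cat (int g1) (a # sublist_idx mu I)
             * Cat (int (g - g1)) (b # sublist_idx mu (?A - I))))"
  proof (intro arg_cong2[where f = "(+)"] sum.cong[OF refl])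
    fix j assume "j \<in> ?V - {0}"
    then show "?d j * gcount (int g) (?V - {j}) (?d(0 := ?d 0 + ?d j - 2))
      = mu ! j * Cat (int g) ((mu ! 0 + mu ! j - 2) # sublist_idx mu (?A - {j}))"
      by (simp only: A)
  next
    fix ab :: "nat \<times> nat"
    obtain a b where ab: "ab = (a, b)" by (cases ab)
    have "gcount (int g1) (insert 0 I) (?d(0 := a, ?n := b))
        * gcount (int (g - g1)) (insert ?n (?V - {0} - I)) (?d(0 := a, ?n := b))
      = Cat (int g1) (a # sublist_idx mu I) * Cat (int (g - g1)) (b # sublist_idx mu (?A - I))"
      if "I \<in> Pow (?V - {0})" for g1 I
      using C[OF that, of "int g1" a b] D[OF that, of "int (g - g1)" b a] by (simp only:)
    then show "(case ab of (a, b) \<Rightarrow> gcount (int g - 1) (insert ?n ?V) (?d(0 := a, ?n := b))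
        + (\<Sum>g1\<in>{0..g}. \<Sum>I\<in>Pow (?V - {0}). gcount (int g1) (insert 0 I) (?d(0 := a, ?n := b))
             * gcount (int (g - g1)) (insert ?n (?V - {0} - I)) (?d(0 := a, ?n := b))))
      = (case ab of (a, b) \<Rightarrow> Cat (int g - 1) (a # b # sublist_idx mu ?A)
        + (\<Sum>g1\<in>{0..g}. \<Sum>I\<in>Pow (?V - {0}). Cat (int g1) (a # sublist_idx mu I)
             * Cat (int (g - g1)) (b # sublist_idx mu (?A - I))))"
      unfolding ab prod.case B by (intro arg_cong2[where f = "(+)"] sum.cong refl)
  qed
  finally show ?thesis unfolding V(2) .
qed

end
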